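(* Let $r\ge 2$ and $1\le \ell\le r-1$ be integers, and let $\alpha=\max\{\ell,\ r-\lceil(\ell+1)/2\rceil\}$. Then, as $n\to\infty$ (with implied positive constants depending only on $r$ and $\ell$), $$\mathrm{ex}_{\to}(n,\mathrm{ord}(I^r(\ell)))=\Omega(n^{\alpha})$$ and $$\mathrm{ex}_{\to}(n,\mathrm{ord}(I^r(\ell)))=\begin{cases} O(n^{\alpha}) & \text{if } \ell \text{ is odd},\\ O(n^{\alpha}\log n) & \text{if } \ell\text{ is even}.\end{cases}$$ Here $I^r(\ell)$ denotes the $r$-graph consisting of two edges sharing exactly $\ell$ vertices.
   Context: An $r$-graph is a finite hypergraph all of whose edges have size $r$; hypergraphs are identified with their edge sets. An ordered $r$-graph is an $r$-graph with a linear ordering of its vertex set. An ordered $r$-graph is interval $r$-partite if there are intervals (sets of consecutive vertices) $I_1<I_2<\dots<I_r$ in the vertex ordering such that every edge has exactly one vertex in each $I_j$ (where $A<B$ means that every element of $A$ precedes every element of $B$). For an $r$-partite $r$-graph $F$, $\mathrm{ord}(F)$ is the family of interval $r$-partite ordered $r$-graphs that are isomorphic to $F$ as unordered $r$-graphs. An ordered $r$-graph $H$ contains an ordered $r$-graph $F$ if there is an order-preserving injection $V(F)\to V(H)$ mapping edges to edges. For a family $\mathcal G$ of ordered $r$-graphs, $\mathrm{ex}_{\to}(n,\mathcal G)$ is the maximum number of edges in an $n$-vertex ordered $r$-graph that contains no member of $\mathcal G$. *)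

theory Defs
  imports Complex_Main "HOL-Library.Landau_Symbols"
begin

text \<open>
  A hypergraph is a pair of a vertex set and an edge set. The ordering of an ordered \<open>r\<close>-graph
  is the one its vertex set inherits from the ambient linearly ordered type. In \<open>ord_family\<close>
  and \<open>ex_ord\<close> this type is \<^typ>\<open>nat\<close>, which loses nothing: every finite linearly ordered set
  is order-isomorphic to a finite set of natural numbers.
\<close>

type_synonym 'a hypergraph = "'a set \<times> 'a set set"

abbreviation verts :: "'a hypergraph \<Rightarrow> 'a set" where "verts \<equiv> fst"
abbreviation edges :: "'a hypergraph \<Rightarrow> 'a set set" where "edges \<equiv> snd"

definition rgraph :: "nat \<Rightarrow> 'a hypergraph \<Rightarrow> bool" where
  "rgraph r H \<longleftrightarrow> finite (verts H) \<and> (\<forall>e\<in>edges H. e \<subseteq> verts H \<and> card e = r)"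

definition hypergraph_iso :: "'a hypergraph \<Rightarrow> 'b hypergraph \<Rightarrow> bool" where
  "hypergraph_iso G H \<longleftrightarrow>
     (\<exists>f. bij_betw f (verts G) (verts H) \<and> (\<lambda>e. f ` e) ` edges G = edges H)"

definition interval_in :: "'a::linorder set \<Rightarrow> 'a set \<Rightarrow> bool" where
  "interval_in V I \<longleftrightarrow> I \<subseteq> V \<and> (\<forall>x\<in>I. \<forall>y\<in>I. \<forall>z\<in>V. x \<le> z \<and> z \<le> y \<longrightarrow> z \<in> I)"

definition interval_partite :: "nat \<Rightarrow> 'a::linorder hypergraph \<Rightarrow> bool" where
  "interval_partite r H \<longleftrightarrow>
     (\<exists>I :: nat \<Rightarrow> 'a set.
        (\<forall>j\<in>{1..r}. interval_in (verts H) (I j)) \<and>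
        (\<forall>i\<in>{1..r}. \<forall>j\<in>{1..r}. i < j \<longrightarrow> (\<forall>x\<in>I i. \<forall>y\<in>I j. x < y)) \<and>
        (\<forall>e\<in>edges H. \<forall>j\<in>{1..r}. card (e \<inter> I j) = 1))"

definition ord_family :: "nat \<Rightarrow> 'a hypergraph \<Rightarrow> nat hypergraph set" where
  "ord_family r F = {G. rgraph r G \<and> interval_partite r G \<and> hypergraph_iso G F}"

definition ord_contains :: "'a::linorder hypergraph \<Rightarrow> 'b::linorder hypergraph \<Rightarrow> bool" where
  "ord_contains H F \<longleftrightarrow>
     (\<exists>f. inj_on f (verts F) \<and> mono_on (verts F) f \<and> f ` verts F \<subseteq> verts H \<and>
          (\<forall>e\<in>edges F. f ` e \<in> edges H))"

definition ex_ord :: "nat \<Rightarrow> nat \<Rightarrow> nat hypergraph set \<Rightarrow> nat" where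
  "ex_ord r n \<G> =
     Max {card (edges H) | H :: nat hypergraph.
            rgraph r H \<and> card (verts H) = n \<and> (\<forall>G\<in>\<G>. \<not> ord_contains H G)}"

text \<open>The two edges of \<open>two_edges r l\<close> meet in \<open>{r - l..<r}\<close>.\<close>

definition two_edges :: "nat \<Rightarrow> nat \<Rightarrow> nat hypergraph" where
  "two_edges r l = ({0..<2 * r - l}, {{0..<r}, {r - l..<2 * r - l}})"

lemma rgraph_two_edges: "l \<le> r \<Longrightarrow> rgraph r (two_edges r l)"
  by (auto simp: rgraph_def two_edges_def)

lemma card_edges_two_edges: "l < r \<Longrightarrow> card (edges (two_edges r l)) = 2"
  by (auto simp: two_edges_def card_insert_if atLeastLessThan_eq_iff)

lemma two_edges_share:
  assumes "l \<le> r"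
  shows "card ({0..<r} \<inter> {r - l..<2 * r - l}) = l"
    and "verts (two_edges r l) = \<Union> (edges (two_edges r l))"
  using assms by (auto simp: two_edges_def)

text \<open>The maximum in \<open>ex_ord\<close> is over a finite nonempty set if every member of the family
  has an edge.\<close>

lemma ex_ord_finite:
  "finite {card (edges H) | H :: nat hypergraph.
     rgraph r H \<and> card (verts H) = n \<and> (\<forall>G\<in>\<G>. \<not> ord_contains H G)}"
proof (rule finite_subset)
  show "{card (edges H) | H :: nat hypergraph.
     rgraph r H \<and> card (verts H) = n \<and> (\<forall>G\<in>\<G>. \<not> ord_contains H G)} \<subseteq> {..2 ^ n}"
  proof clarsimp
    fix V :: "nat set" and E
    assume "rgraph r (V, E)"
    then have "finite V" "E \<subseteq> Pow V" by (auto simp: rgraph_def)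
    then show "card E \<le> 2 ^ card V"
      using card_mono[of "Pow V" E] by (simp add: card_Pow)
  qed
qed simp

lemma ex_ord_nonempty:
  assumes "\<And>G. G \<in> \<G> \<Longrightarrow> edges G \<noteq> {}"
  shows "{card (edges H) | H :: nat hypergraph.
     rgraph r H \<and> card (verts H) = n \<and> (\<forall>G\<in>\<G>. \<not> ord_contains H G)} \<noteq> {}"
proof -
  have "rgraph r ({..<n}, {}) \<and> card (verts ({..<n}, {})) = n \<and>
        (\<forall>G\<in>\<G>. \<not> ord_contains ({..<n}, {}) G)"
    using assms by (force simp: rgraph_def ord_contains_def)
  then show ?thesis by blast
qed

lemma ord_family_two_edges_nonempty_edges:
  "G \<in> ord_family r (two_edges r l) \<Longrightarrow> edges G \<noteq> {}"
  by (auto simp: ord_family_def hypergraph_iso_def two_edges_def)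

end

theory Submission
  imports Defs "HOL-Library.FuncSet"
begin

text \<open>
  Write edges as increasing tuples. Two edges then form a member of the forbidden family iff their
  tuples are interleaved and agree in exactly \<open>l\<close> entries.

  For the upper bound, sort the edges by the largest scale \<open>b = 2 ^ i\<close> at which they still meet
  at least \<open>k = r - (l + 1) div 2\<close> blocks \<open>[c b, (c + 1) b)\<close>, and then by the vector of blocks of their
  entries. As fewer than \<open>k\<close> blocks are met at scale \<open>2 b\<close>, there are \<open>O((n / b) ^ (k - 1))\<close> vectors.
  Edges with the same vector that differ only in first entries of blocks are interleaved, so in
  such a class no two edges may differ in exactly \<open>r - l\<close> of these first entries. The delta-system
  method of Frankl and Fueredi then bounds each class by \<open>O(b ^ \<alpha>)\<close>. Summing over the dyadic scales
  gives \<open>O(n ^ \<alpha>)\<close> if \<open>k \<le> \<alpha>\<close>, and one logarithm if \<open>k = \<alpha> + 1\<close>.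

  The lower bounds come from the value tables of polynomials of degree less than \<open>l\<close>, and from
  edges containing \<open>l div 2 + 1\<close> pairs of the form \<open>{2 y, 2 y + 1}\<close>.
\<close>

section \<open>Intersections of prescribed size\<close>

text \<open>Otherwise the degree of \<open>y\<close> is at most \<open>card (D x)\<close> at every
  incidence. Summing \<open>1 / card (D x)\<close> over the incidences gives \<open>card T\<close>,
  while summing inverse degrees gives at most \<open>card R\<close>, contradicting
  \<open>card R < card T\<close>.\<close>

lemma ex_incidence_degree_gt:
  fixes D :: "'a \<Rightarrow> 'b set"
  assumes fin: "finite T" "finite R"
    and sub: "\<And>x. x \<in> T \<Longrightarrow> D x \<subseteq> R" and ne: "\<And>x. x \<in> T \<Longrightarrow> D x \<noteq> {}"
    and card: "card R < card T"
  shows "\<exists>x\<in>T. \<exists>y\<in>D x. card (D x) < card {z\<in>T. y \<in> D z}"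
proof (rule ccontr)
  assume "\<not> ?thesis"
  then have le: "card {z\<in>T. y \<in> D z} \<le> card (D x)" if "x \<in> T" "y \<in> D x" for x y
    using that by (meson not_less)
  have finD: "finite (D x)" if "x \<in> T" for x
    using that sub fin finite_subset by blast
  have "real (card T) = (\<Sum>x\<in>T. \<Sum>y\<in>D x. 1 / real (card (D x)))"
    using ne finD by (simp add: card_eq_0_iff)
  also have "\<dots> \<le> (\<Sum>x\<in>T. \<Sum>y\<in>D x. 1 / real (card {z\<in>T. y \<in> D z}))"
  proof (intro sum_mono)
    fix x y assume xy: "x \<in> T" "y \<in> D x"
    then have "card {z\<in>T. y \<in> D z} > 0"
      using fin by (auto simp: card_gt_0_iff)
    then show "1 / real (card (D x)) \<le> 1 / real (card {z\<in>T. y \<in> D z})"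
      using le[OF xy] by (intro divide_left_mono) auto
  qed
  also have "\<dots> = (\<Sum>x\<in>T. \<Sum>y\<in>{y\<in>R. y \<in> D x}. 1 / real (card {z\<in>T. y \<in> D z}))"
    using sub by (intro sum.cong) auto
  also have "\<dots> = (\<Sum>y\<in>R. \<Sum>x\<in>{x\<in>T. y \<in> D x}. 1 / real (card {z\<in>T. y \<in> D z}))"
    by (rule sum.swap_restrict) (use fin in auto)
  also have "\<dots> \<le> (\<Sum>y\<in>R. 1)"
    by (intro sum_mono) simp
  finally show False using card by simp
qed

text \<open>A theorem of Frankl and Katona. If no \<open>D x\<close> is empty, weighting each incidence \<open>y \<in> D x\<close>
  by the inverse of \<open>card (D x)\<close> and of the degree of \<open>y\<close> gives an incidence at which the degree
  is larger; there the claim for the remaining sets through \<open>y\<close>, traced on \<open>D x - {y}\<close>, suffices.\<close>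

lemma Frankl_Katona_one:
  fixes D :: "'a \<Rightarrow> 'b set"
  assumes "finite T" "finite R" "\<And>x. x \<in> T \<Longrightarrow> D x \<subseteq> R" "card R < card T"
  shows "\<exists>T'\<subseteq>T. T' \<noteq> {} \<and> card (\<Inter>x\<in>T'. D x) + 1 = card T'"
  using assms
proof (induction "card R" arbitrary: R T D rule: less_induct)
  case less
  show ?case
  proof (cases "\<exists>x\<in>T. D x = {}")
    case True
    then obtain x where "x \<in> T" "D x = {}" by blast
    then show ?thesis by (intro exI[of _ "{x}"]) auto
  next
    case False
    then obtain x y where xy: "x \<in> T" "y \<in> D x" "card (D x) < card {z\<in>T. y \<in> D z}"
      using ex_incidence_degree_gt[of T R D] less.prems by blast
    define R' where "R' = D x - {y}"
    define S where "S = {z\<in>T. y \<in> D z} - {x}"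
    have finD: "finite (D x)" using xy less.prems finite_subset by metis
    have cR': "card R' + 1 = card (D x)"
      using xy finD by (simp add: R'_def card_gt_0_iff Suc_leI card_Diff_singleton)
        (metis One_nat_def Suc_pred card_gt_0_iff empty_iff)
    have "card R' < card R"
      using cR' card_mono[of R "D x"] less.prems xy by fastforce
    moreover have "card S + 1 = card {z\<in>T. y \<in> D z}"
      using xy less.prems by (simp add: S_def card_Suc_Diff1)
    then have "card R' < card S" using xy cR' by linarith
    moreover have "finite S" "finite R'" using less.prems finD by (auto simp: S_def R'_def)
    ultimately have "\<exists>T'\<subseteq>S. T' \<noteq> {} \<and> card (\<Inter>z\<in>T'. D z \<inter> R') + 1 = card T'"
      by (intro less.hyps) auto
    then obtain T' where T': "T' \<subseteq> S" "T' \<noteq> {}" "card (\<Inter>z\<in>T'. D z \<inter> R') + 1 = card T'"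
      by blast
    \<comment> \<open>Adding \<open>x\<close> back cuts all sets down to \<open>D x\<close> and
      restores \<open>y\<close>, so the intersection of the traces and the subfamily both grow by
      one.\<close>
    have eq: "(\<Inter>z\<in>insert x T'. D z) = insert y (\<Inter>z\<in>T'. D z \<inter> R')"
      using T' xy by (auto simp: S_def R'_def)
    have "finite (\<Inter>z\<in>T'. D z \<inter> R')"
      using T' finD by (metis INF_lower2 Int_lower2 R'_def ex_in_conv finite_Diff finite_subset)
    moreover have "y \<notin> (\<Inter>z\<in>T'. D z \<inter> R')" using T' by (auto simp: R'_def)
    ultimately have "card (\<Inter>z\<in>insert x T'. D z) = card T'"
      using T' by (simp only: eq card_insert_disjoint) simp
    moreover have "x \<notin> T'" "finite T'"
      using T' \<open>finite S\<close> finite_subset by (auto simp: S_def)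
    ultimately show ?thesis
      using T' xy by (intro exI[of _ "insert x T'"]) (auto simp: S_def)
  qed
qed

text \<open>Induction on \<open>s\<close>: the other sets are traced on one set \<open>D x\<close>.
  Putting \<open>x\<close> back enlarges the subfamily by one and leaves the intersection of the
  traces unchanged.\<close>

lemma Frankl_Katona:
  fixes D :: "'a \<Rightarrow> 'b set"
  assumes "finite T" "finite R" "\<And>x. x \<in> T \<Longrightarrow> D x \<subseteq> R" "card R + s < card T"
  shows "\<exists>T'\<subseteq>T. T' \<noteq> {} \<and> card (\<Inter>x\<in>T'. D x) + Suc s = card T'"
  using assms
proof (induction s arbitrary: T R D)
  case 0
  then show ?case using Frankl_Katona_one[of T R D] by simp
next
  case (Suc s)
  then obtain x where x: "x \<in> T" by fastforce
  have "finite (D x)" "card (D x) \<le> card R"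
    using Suc.prems x by (auto intro: finite_subset card_mono)
  moreover have "card (T - {x}) + 1 = card T" using x Suc.prems by (simp add: card_Suc_Diff1)
  ultimately have "\<exists>T'\<subseteq>T - {x}. T' \<noteq> {} \<and> card (\<Inter>z\<in>T'. D z \<inter> D x) + Suc s = card T'"
    using Suc.prems by (intro Suc.IH[of _ "D x"]) auto
  then obtain T' where T': "T' \<subseteq> T - {x}" "T' \<noteq> {}"
      "card (\<Inter>z\<in>T'. D z \<inter> D x) + Suc s = card T'"
    by blast
  have "(\<Inter>z\<in>insert x T'. D z) = (\<Inter>z\<in>T'. D z \<inter> D x)" using T' by auto
  moreover have "card (insert x T') = Suc (card T')"
    using T' Suc.prems finite_subset by (subst card_insert_disjoint) auto
  ultimately show ?case
    using T' x by (intro exI[of _ "insert x T'"]) (auto simp del: INT_insert)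
qed

text \<open>Take a largest \<open>R\<close> inside \<open>Q\<close> that contains no nonempty member
  of \<B>; it has fewer than \<open>d\<close> elements. By maximality each \<open>x\<close> in
  \<open>Q - R\<close> has a member \<open>B x\<close> of \<B> with \<open>x \<in> B x\<close> and
  \<open>B x \<subseteq> insert x R\<close>. The Frankl-Katona theorem for the sets
  \<open>R - B x\<close> selects the \<open>B x\<close> whose union has the right size.\<close>

lemma ex_Union_card_eq:
  fixes \<B> :: "'a set set"
  assumes fin: "finite Q"
    and dense: "\<And>D. D \<subseteq> Q \<Longrightarrow> card D = d \<Longrightarrow> \<exists>B\<in>\<B>. B \<noteq> {} \<and> B \<subseteq> D"
    and "d \<le> q" "q + d \<le> card Q + 1"
  shows "\<exists>\<C>\<subseteq>\<B>. finite \<C> \<and> card \<C> \<le> q \<and> \<Union>\<C> \<subseteq> Q \<and> card (\<Union>\<C>) = q"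
proof -
  define indep where "indep X \<longleftrightarrow> X \<subseteq> Q \<and> (\<forall>B\<in>\<B>. B \<noteq> {} \<longrightarrow> \<not> B \<subseteq> X)" for X
  have "indep {}" by (auto simp: indep_def)
  moreover have bd: "card X < d" if "indep X" for X
  proof (rule ccontr)
    assume "\<not> card X < d"
    then obtain D where "D \<subseteq> X" "card D = d" by (meson obtain_subset_with_card_n not_less)
    then show False using dense[of D] that unfolding indep_def by (meson order_trans)
  qed
  ultimately obtain R where R: "indep R" and Rmax: "\<And>X. indep X \<Longrightarrow> card X \<le> card R"
    using ex_has_greatest_nat[of indep "{}" card d] by (metis less_imp_le)
  have finR: "finite R" and RQ: "R \<subseteq> Q" using R fin finite_subset by (auto simp: indep_def)
  have "\<exists>B. B \<in> \<B> \<and> x \<in> B \<and> B \<subseteq> insert x R" if x: "x \<in> Q - R" for x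
  proof -
    have "\<not> indep (insert x R)" using Rmax[of "insert x R"] finR x by auto
    then obtain B where B: "B \<in> \<B>" "B \<noteq> {}" "B \<subseteq> insert x R"
      using RQ x by (auto simp: indep_def)
    then have "\<not> B \<subseteq> R" using R by (auto simp: indep_def)
    then show ?thesis using B by blast
  qed
  then obtain B where B: "\<And>x. x \<in> Q - R \<Longrightarrow> B x \<in> \<B> \<and> x \<in> B x \<and> B x \<subseteq> insert x R"
    by metis
  have cR: "card R < d" using bd R by blast
  \<comment> \<open>The union of the \<open>B x\<close> over \<open>T\<close> has
    \<open>card T + card R\<close> elements minus the size of the intersection of the sets
    \<open>R - B x\<close>; this \<open>s\<close> makes the result \<open>q\<close>.\<close>
  define s where "s = q - card R - 1"
  have s: "card R + Suc s = q" using cR assms(3) by (simp add: s_def)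
  have "card (Q - R) = card Q - card R" using RQ finR by (simp add: card_Diff_subset)
  then have "card R + s < card (Q - R)" using s cR assms(4) by linarith
  then have "\<exists>T\<subseteq>Q - R. T \<noteq> {} \<and> card (\<Inter>x\<in>T. R - B x) + Suc s = card T"
    using finR fin by (intro Frankl_Katona) auto
  then obtain T where T: "T \<subseteq> Q - R" "T \<noteq> {}" "card (\<Inter>x\<in>T. R - B x) + Suc s = card T"
    by blast
  have finT: "finite T" using T fin finite_subset by auto
  have "(\<Inter>x\<in>T. R - B x) = R - \<Union>(B ` T)" using T by auto
  then have I: "card R = card (\<Inter>x\<in>T. R - B x) + card (R \<inter> \<Union>(B ` T))"
    by (metis card_Int_Diff finR add.commute)
  have "\<Union>(B ` T) = T \<union> (R \<inter> \<Union>(B ` T))" using B T by blast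
  moreover have "card (T \<union> (R \<inter> \<Union>(B ` T))) = card T + card (R \<inter> \<Union>(B ` T))"
    using T finT finR by (intro card_Un_disjoint) auto
  ultimately have c: "card (\<Union>(B ` T)) = q" using I T s by simp
  have "T \<subseteq> \<Union>(B ` T)" using B T by blast
  moreover have sub: "\<Union>(B ` T) \<subseteq> Q" using B T RQ by blast
  ultimately have "card T \<le> q" using c fin by (metis card_mono finite_subset)
  then have "card (B ` T) \<le> q" using card_image_le[OF finT] le_trans by blast
  then show ?thesis using c sub B T finT by (intro exI[of _ "B ` T"]) auto
qed

section \<open>Families of functions avoiding a Hamming distance\<close>

text \<open>This plays the part of a large sunflower whose kernel is \<open>e\<close> off
  \<open>B\<close>: on \<open>B\<close> any one prescribed value per coordinate can be
  avoided.\<close>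

definition free_at :: "('i \<Rightarrow> 'v) set \<Rightarrow> 'i set \<Rightarrow> ('i \<Rightarrow> 'v) \<Rightarrow> bool" where
  "free_at E B e \<longleftrightarrow> (\<forall>a. \<exists>f\<in>E. (\<forall>i. i \<notin> B \<longrightarrow> f i = e i) \<and> (\<forall>i\<in>B. f i \<noteq> a i))"

lemma free_at_mono: "free_at E B e \<Longrightarrow> E \<subseteq> E' \<Longrightarrow> free_at E' B e"
  unfolding free_at_def by blast

text \<open>Either \<open>D\<close> is free at \<open>e\<close>, or some \<open>a\<close> agrees
  with every member of \<open>M\<close> in a coordinate of \<open>D\<close>. By pigeonhole one
  equation \<open>f i = a i\<close> then holds for more than \<open>fact (card D - 1)\<close>
  members, and the induction continues with \<open>D - {i}\<close>.\<close>

lemma ex_free_at: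
  assumes "finite D" "finite M" "\<And>f g i. f \<in> M \<Longrightarrow> g \<in> M \<Longrightarrow> i \<notin> D \<Longrightarrow> f i = g i"
    and "fact (card D) < card M"
  shows "\<exists>e\<in>M. \<exists>B\<subseteq>D. B \<noteq> {} \<and> free_at M B e"
  using assms
proof (induction "card D" arbitrary: D M)
  case 0
  then have "f = g" if "f \<in> M" "g \<in> M" for f g
    using that by auto
  then have "card M \<le> 1" using \<open>finite M\<close> by (auto simp: card_le_Suc0_iff_eq)
  then show ?case using 0 by simp
next
  case (Suc n)
  from Suc.prems(4) obtain e where e: "e \<in> M" by fastforce
  show ?case
  proof (cases "free_at M D e")
    case True
    then show ?thesis using e Suc.hyps(2) by (intro bexI[of _ e] exI[of _ D]) auto
  next
    case False
    then obtain a where a: "\<And>f. f \<in> M \<Longrightarrow> \<exists>i\<in>D. f i = a i"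
      using Suc.prems(3) e unfolding free_at_def by meson
    have "card M \<le> card (\<Union>i\<in>D. {f\<in>M. f i = a i})"
      using a Suc.prems(1,2) by (intro card_mono) auto
    also have "\<dots> \<le> (\<Sum>i\<in>D. card {f\<in>M. f i = a i})"
      by (rule card_UN_le[OF Suc.prems(1)])
    finally have le: "card M \<le> (\<Sum>i\<in>D. card {f\<in>M. f i = a i})" .
    have "\<exists>i\<in>D. fact n < card {f\<in>M. f i = a i}"
    proof (rule ccontr)
      assume "\<not> ?thesis"
      then have "(\<Sum>i\<in>D. card {f\<in>M. f i = a i}) \<le> (\<Sum>i\<in>D. fact n)"
        by (intro sum_mono) (simp add: not_less)
      also have "\<dots> = fact (card D)" by (simp flip: Suc.hyps(2))
      finally show False using le Suc.prems(4) by linarith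
    qed
    then obtain i where i: "i \<in> D" "fact n < card {f\<in>M. f i = a i}" by blast
    have n: "n = card (D - {i})" using i Suc.prems Suc.hyps(2) by simp
    have "\<exists>e\<in>{f\<in>M. f i = a i}. \<exists>B\<subseteq>D - {i}. B \<noteq> {} \<and> free_at {f\<in>M. f i = a i} B e"
    proof (rule Suc.hyps(1)[OF n])
      fix f g j assume "f \<in> {f\<in>M. f i = a i}" "g \<in> {f\<in>M. f i = a i}" "j \<notin> D - {i}"
      then show "f j = g j" using Suc.prems(3)[of f g j] by (cases "j = i") auto
    qed (use Suc.prems i n in auto)
    then show ?thesis using free_at_mono[of "{f\<in>M. f i = a i}" _ _ M] by blast
  qed
qed

lemma card_le_if_fibres_le:
  assumes "finite Y" "f ` X \<subseteq> Y" "\<And>y. y \<in> Y \<Longrightarrow> card {x\<in>X. f x = y} \<le> c"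
  shows "card X \<le> c * card Y"
proof -
  have "card X = card (\<Union>y\<in>Y. {x\<in>X. f x = y})"
    using assms(2) by (intro arg_cong[of _ _ card]) blast
  also have "\<dots> \<le> (\<Sum>y\<in>Y. card {x\<in>X. f x = y})"
    by (rule card_UN_le[OF assms(1)])
  also have "\<dots> \<le> (\<Sum>y\<in>Y. c)" by (intro sum_mono assms(3))
  finally show ?thesis by (simp add: mult.commute)
qed

text \<open>Once the values off \<open>D\<close> are fixed, at most \<open>fact (card D)\<close>
  members remain by \<open>ex_free_at\<close>; there are at most
  \<open>b ^ (card I - card D)\<close> ways to fix them.\<close>

lemma card_le_if_no_free_at:
  assumes fin: "finite I" "\<And>i. i \<in> I \<Longrightarrow> finite (J i)" and b: "\<And>i. i \<in> I \<Longrightarrow> card (J i) \<le> b"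
    and E: "E \<subseteq> PiE I J" and D: "D \<subseteq> I"
    and nf: "\<And>e B. e \<in> E \<Longrightarrow> B \<subseteq> D \<Longrightarrow> B \<noteq> {} \<Longrightarrow> \<not> free_at E B e"
  shows "card E \<le> fact (card D) * b ^ (card I - card D)"
proof -
  have finE: "finite E" using E fin finite_PiE finite_subset by metis
  have finD: "finite D" using D fin finite_subset by blast
  have "card E \<le> fact (card D) * card (PiE (I - D) J)"
  proof (rule card_le_if_fibres_le)
    show "finite (PiE (I - D) J)" using fin by (intro finite_PiE) auto
    show "(\<lambda>f. restrict f (I - D)) ` E \<subseteq> PiE (I - D) J" using E by fastforce
    fix y
    let ?M = "{f\<in>E. restrict f (I - D) = y}"
    show "card ?M \<le> fact (card D)"
    proof (rule ccontr)
      assume "\<not> ?thesis"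
      then have "\<exists>e\<in>?M. \<exists>B\<subseteq>D. B \<noteq> {} \<and> free_at ?M B e"
      proof (intro ex_free_at)
        fix f g i assume fg: "f \<in> ?M" "g \<in> ?M" "i \<notin> D"
        show "f i = g i"
        proof (cases "i \<in> I")
          case True
          then show ?thesis using fg by (metis (mono_tags, lifting) DiffI mem_Collect_eq restrict_apply')
        next
          case False
          then show ?thesis using fg E by (metis (mono_tags, lifting) PiE_arb mem_Collect_eq subsetD)
        qed
      qed (use finD finE in auto)
      then show False using nf free_at_mono[of ?M _ _ E] by blast
    qed
  qed
  also have "card (PiE (I - D) J) = (\<Prod>i\<in>I - D. card (J i))"
    using fin by (simp add: card_PiE)
  also have "\<dots> \<le> (\<Prod>i\<in>I - D. b)" using b by (intro prod_mono) auto
  also have "\<dots> = b ^ (card I - card D)" using D finD by (simp add: card_Diff_subset)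
  finally show ?thesis by simp
qed

text \<open>Each entry of the list is one move and costs one level of \<open>A\<close>. With
  \<open>e\<close> itself as the values to avoid, a move along \<open>B\<close> keeps all earlier
  differences from \<open>e\<close> and adds those in \<open>B\<close>.\<close>

lemma free_at_chain:
  assumes "\<And>i e B. e \<in> A (Suc i) \<Longrightarrow> B \<in> \<B> \<Longrightarrow> free_at (A i) B e"
    and "set Bs \<subseteq> \<B>" "f \<in> A (length Bs)" "\<And>i. f i \<noteq> e i \<longleftrightarrow> i \<in> U"
  shows "\<exists>g\<in>A 0. \<forall>i. g i \<noteq> e i \<longleftrightarrow> i \<in> U \<union> \<Union>(set Bs)"
  using assms(2-)
proof (induction Bs arbitrary: f U)
  case Nil
  then show ?case by auto
next
  case (Cons B Bs)
  then have "free_at (A (length Bs)) B f" using assms(1) by simp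
  then obtain g where g: "g \<in> A (length Bs)" "\<And>i. i \<notin> B \<Longrightarrow> g i = f i" "\<And>i. i \<in> B \<Longrightarrow> g i \<noteq> e i"
    unfolding free_at_def by blast
  have "\<And>i. g i \<noteq> e i \<longleftrightarrow> i \<in> U \<union> B" using g Cons.prems(3) by (metis Un_iff)
  then have "\<exists>h\<in>A 0. \<forall>i. h i \<noteq> e i \<longleftrightarrow> i \<in> (U \<union> B) \<union> \<Union>(set Bs)"
    using Cons.prems g(1) by (intro Cons.IH) auto
  then show ?case by (simp add: Un_assoc)
qed

text \<open>Induction on the size of a family \<open>\<B>\<close> containing all sets that are free somewhere in \<open>E\<close>.
  Let \<open>A i\<close> be the members of \<open>E\<close> at which \<open>i\<close> rounds of moves along members of \<open>\<B>\<close> are possible.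
  If \<open>A (card I)\<close> is nonempty, such moves change exactly the coordinates in a union of members
  of \<open>\<B>\<close> of size \<open>q\<close>. Otherwise \<open>E\<close> is covered by few subfamilies in each of which some member
  of \<open>\<B>\<close> is never free.\<close>

lemma card_le_if_no_distance_aux:
  fixes J :: "'i \<Rightarrow> 'v set"
  assumes fin: "finite I" "\<And>i. i \<in> I \<Longrightarrow> finite (J i)" and b: "\<And>i. i \<in> I \<Longrightarrow> card (J i) \<le> b"
    and Q: "Q \<subseteq> I" and q: "0 < q" "q \<le> card I" "card I \<le> q + \<alpha>" "card I + q \<le> card Q + \<alpha> + 1" "\<alpha> \<le> card I"
    and E: "E \<subseteq> PiE I J"
    and avoid: "\<And>f g. f \<in> E \<Longrightarrow> g \<in> E \<Longrightarrow> {i. f i \<noteq> g i} \<subseteq> Q \<Longrightarrow> card {i. f i \<noteq> g i} \<noteq> q"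
    and \<B>: "finite \<B>" "\<And>e B. e \<in> E \<Longrightarrow> B \<subseteq> Q \<Longrightarrow> B \<noteq> {} \<Longrightarrow> free_at E B e \<Longrightarrow> B \<in> \<B>"
  shows "card E \<le> fact (card I) * card I ^ card \<B> * fact (card \<B>) * b ^ \<alpha>"
  using E avoid \<B>
proof (induction "card \<B>" arbitrary: E \<B> rule: less_induct)
  case less
  define r where "r = card I"
  \<comment> \<open>Off a set of \<open>d\<close> coordinates there are \<open>\<alpha>\<close>
    coordinates left, hence at most \<open>b ^ \<alpha>\<close> choices.\<close>
  define d where "d = r - \<alpha>"
  \<comment> \<open>Solves \<open>c m = r * m * c (m - 1)\<close>: the induction step has one
    subfamily for each of \<open>r\<close> levels and \<open>m\<close> members of \<B>.\<close>
  define c :: "nat \<Rightarrow> nat" where "c m = fact r * r ^ m * fact m" for m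
  have finQ: "finite Q" using Q fin finite_subset by blast
  have finE: "finite E" using less.prems(1) fin finite_PiE finite_subset by metis
  show ?case
  proof (cases "E = {}")
    case True
    then show ?thesis by simp
  next
    case nonempty: False
    show ?thesis
    proof (cases "\<exists>D\<subseteq>Q. card D = d \<and> (\<forall>B\<in>\<B>. B \<noteq> {} \<longrightarrow> \<not> B \<subseteq> D)")
      case True
      then obtain D where D: "D \<subseteq> Q" "card D = d" "\<And>B. B \<in> \<B> \<Longrightarrow> B \<noteq> {} \<Longrightarrow> \<not> B \<subseteq> D" by blast
      have "\<not> free_at E B e" if "e \<in> E" "B \<subseteq> D" "B \<noteq> {}" for e B
        using that D less.prems(4)[of e B] by blast
      then have "card E \<le> fact (card D) * b ^ (card I - card D)"
        using fin b less.prems(1) D(1) Q by (intro card_le_if_no_free_at[of I J]) auto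
      also have "\<dots> = fact d * b ^ \<alpha>" using D q by (simp add: d_def r_def)
      also have "fact d * b ^ \<alpha> \<le> c (card \<B>) * b ^ \<alpha>"
      proof (intro mult_right_mono)
        have "r ^ card \<B> \<ge> 1" using q by (simp add: r_def)
        then have "fact r * 1 * 1 \<le> c (card \<B>)"
          unfolding c_def by (intro mult_mono) (auto simp: fact_ge_1)
        moreover have "(fact d :: nat) \<le> fact r" by (intro fact_mono) (simp add: d_def)
        ultimately show "fact d \<le> c (card \<B>)" by simp
      qed simp
      finally show ?thesis by (simp add: c_def r_def)
    next
      case False
      define A where "A = rec_nat E (\<lambda>_ X. {e\<in>X. \<forall>B\<in>\<B>. free_at X B e})"
      have A0: "A 0 = E" and AS: "A (Suc i) = {e\<in>A i. \<forall>B\<in>\<B>. free_at (A i) B e}" for i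
        by (simp_all add: A_def)
      have anti: "A j \<subseteq> A i" if "i \<le> j" for i j
        using that by (induction rule: dec_induct) (auto simp: AS)
      have "A r = {}"
      proof (rule ccontr)
        assume "A r \<noteq> {}"
        then obtain e where e: "e \<in> A r" by blast
        \<comment> \<open>Here every \<open>d\<close>-subset of \<open>Q\<close> contains a nonempty
          member of \<B>. A union of at most \<open>q \<le> r\<close> members is then realised by as
          many moves, which \<open>e\<close> permits.\<close>
        have "\<exists>\<C>\<subseteq>\<B>. finite \<C> \<and> card \<C> \<le> q \<and> \<Union>\<C> \<subseteq> Q \<and> card (\<Union>\<C>) = q"
        proof (rule ex_Union_card_eq[OF finQ])
          show "\<exists>B\<in>\<B>. B \<noteq> {} \<and> B \<subseteq> D" if "D \<subseteq> Q" "card D = d" for D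
            using False that by blast
        qed (use q in \<open>auto simp: d_def r_def\<close>)
        then obtain \<C> where \<C>: "\<C> \<subseteq> \<B>" "finite \<C>" "card \<C> \<le> q" "\<Union>\<C> \<subseteq> Q" "card (\<Union>\<C>) = q" by blast
        obtain Bs where Bs: "set Bs = \<C>" "distinct Bs" using finite_distinct_list[OF \<C>(2)] by blast
        then have "length Bs \<le> r" using \<C> q by (metis distinct_card le_trans r_def)
        then have eA: "e \<in> A (length Bs)" using e anti by blast
        have "\<exists>g\<in>A 0. \<forall>i. g i \<noteq> e i \<longleftrightarrow> i \<in> {} \<union> \<Union>(set Bs)"
          using eA Bs \<C> by (intro free_at_chain[of A \<B> Bs e]) (auto simp: AS)
        then obtain g where g: "g \<in> E" "\<And>i. g i \<noteq> e i \<longleftrightarrow> i \<in> \<Union>\<C>"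
          using A0 Bs by auto
        have "e \<in> E" using e anti[of 0 r] A0 by auto
        moreover have "{i. g i \<noteq> e i} = \<Union>\<C>" using g by blast
        ultimately show False using less.prems(2)[OF g(1)] \<C> by metis
      qed
      have cover: "e \<in> A i \<Longrightarrow> e \<notin> A (i + m) \<Longrightarrow>
          \<exists>j\<in>{i..<i + m}. \<exists>B\<in>\<B>. e \<in> A j \<and> \<not> free_at (A j) B e" for e i m
      proof (induction m)
        case (Suc m)
        then show ?case
          by (cases "e \<in> A (i + m)") (force simp: AS)+
      qed simp
      \<comment> \<open>\<open>B\<close> is nowhere free in \<open>F i B\<close>, as freeness there
        would imply freeness in the larger \<open>A i\<close>. So the induction hypothesis applies
        with \<B> reduced by \<open>B\<close>.\<close>
      define F where "F i B = {e\<in>A i. \<not> free_at (A i) B e}" for i B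
      have sub: "E \<subseteq> (\<Union>i\<in>{..<r}. \<Union>B\<in>\<B>. F i B)"
      proof
        fix e assume "e \<in> E"
        then show "e \<in> (\<Union>i\<in>{..<r}. \<Union>B\<in>\<B>. F i B)"
          using cover[of e 0 r] A0 \<open>A r = {}\<close> by (auto simp: F_def)
      qed
      then have "\<B> \<noteq> {}" using nonempty by auto
      then have m: "card \<B> = Suc (card \<B> - 1)" using less.prems(3) by (simp add: card_gt_0_iff)
      have FE: "F i B \<subseteq> E" for i B using anti[of 0 i] A0 by (auto simp: F_def)
      have bound: "card (F i B) \<le> c (card \<B> - 1) * b ^ \<alpha>" if "B \<in> \<B>" for i B
      proof -
        have cB: "card (\<B> - {B}) = card \<B> - 1" using that by simp
        have nf: "\<not> free_at (F i B) B e" if "e \<in> F i B" for e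
          using that free_at_mono[of "F i B" B e "A i"] by (auto simp: F_def)
        have "card (F i B) \<le> fact (card I) * card I ^ card (\<B> - {B}) * fact (card (\<B> - {B})) * b ^ \<alpha>"
        proof (rule less.hyps)
          show "card (\<B> - {B}) < card \<B>" using cB m by linarith
          show "F i B \<subseteq> PiE I J" using FE less.prems(1) by blast
          show "card {i. f i \<noteq> g i} \<noteq> q"
            if "f \<in> F i B" "g \<in> F i B" "{i. f i \<noteq> g i} \<subseteq> Q" for f g
            using that FE less.prems(2) by blast
          show "finite (\<B> - {B})" using less.prems(3) by simp
          show "B' \<in> \<B> - {B}" if "e \<in> F i B" "B' \<subseteq> Q" "B' \<noteq> {}" "free_at (F i B) B' e" for e B'
            using that nf FE less.prems(4)[of e B'] free_at_mono[of "F i B" B' e E] by blast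
        qed
        then show ?thesis using cB by (simp add: c_def r_def)
      qed
      have "finite (F i B)" for i B using FE finE finite_subset by blast
      then have "card E \<le> card (\<Union>i\<in>{..<r}. \<Union>B\<in>\<B>. F i B)"
        using sub less.prems(3) by (intro card_mono) auto
      also have "\<dots> \<le> (\<Sum>i<r. card (\<Union>B\<in>\<B>. F i B))" by (intro card_UN_le) simp
      also have "\<dots> \<le> (\<Sum>i<r. \<Sum>B\<in>\<B>. card (F i B))"
        using less.prems(3) by (intro sum_mono card_UN_le)
      also have "\<dots> \<le> (\<Sum>i<r. \<Sum>B\<in>\<B>. c (card \<B> - 1) * b ^ \<alpha>)"
        by (intro sum_mono bound)
      also have "\<dots> = r * (card \<B> * (c (card \<B> - 1) * b ^ \<alpha>))" by simp
      also have "\<dots> = c (card \<B>) * b ^ \<alpha>"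
        by (subst (1 3) m) (simp add: c_def algebra_simps flip: m)
      finally show ?thesis by (simp add: c_def r_def)
    qed
  qed
qed

text \<open>The constant of the preceding bound for \<B> equal to the full power set of
  \<open>r\<close> coordinates.\<close>

definition distance_const :: "nat \<Rightarrow> nat" where
  "distance_const r = fact r * r ^ 2 ^ r * fact (2 ^ r)"

lemma card_le_if_no_distance:
  fixes J :: "'i \<Rightarrow> 'v set"
  assumes fin: "finite I" "\<And>i. i \<in> I \<Longrightarrow> finite (J i)" and b: "\<And>i. i \<in> I \<Longrightarrow> card (J i) \<le> b"
    and Q: "Q \<subseteq> I" and q: "0 < q" "q \<le> card I" "card I \<le> q + \<alpha>"
      "card I + q \<le> card Q + \<alpha> + 1" "\<alpha> \<le> card I"
    and E: "E \<subseteq> PiE I J"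
    and avoid: "\<And>f g. f \<in> E \<Longrightarrow> g \<in> E \<Longrightarrow> {i. f i \<noteq> g i} \<subseteq> Q \<Longrightarrow> card {i. f i \<noteq> g i} \<noteq> q"
  shows "card E \<le> distance_const (card I) * b ^ \<alpha>"
proof -
  have "card E \<le> fact (card I) * card I ^ card (Pow I) * fact (card (Pow I)) * b ^ \<alpha>"
    using assms by (intro card_le_if_no_distance_aux[of I J b Q q]) auto
  then show ?thesis using fin by (simp add: distance_const_def card_Pow)
qed

section \<open>The upper bound for families of increasing tuples\<close>

text \<open>For increasing tuples: the intervals spanned by \<open>f j\<close> and
  \<open>g j\<close> follow one another in the order of \<open>j\<close>, so that the two edges form
  an interval \<open>r\<close>-partite pair.\<close>

definition interleaved :: "nat \<Rightarrow> (nat \<Rightarrow> nat) \<Rightarrow> (nat \<Rightarrow> nat) \<Rightarrow> bool" where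
  "interleaved r f g \<longleftrightarrow> (\<forall>i j. i < j \<longrightarrow> j < r \<longrightarrow> f i < g j \<and> g i < f j)"

text \<open>Extensional functions make increasing tuples correspond one to one to edges. The pair
  \<open>f = g\<close> agrees in \<open>r\<close> entries, so it causes no conflict when
  \<open>l < r\<close>.\<close>

definition avoiding_tuples :: "nat \<Rightarrow> nat \<Rightarrow> nat \<Rightarrow> (nat \<Rightarrow> nat) set \<Rightarrow> bool" where
  "avoiding_tuples r l n A \<longleftrightarrow>
     A \<subseteq> {f \<in> {..<r} \<rightarrow>\<^sub>E {..<n}. strict_mono_on {..<r} f} \<and>
     (\<forall>f\<in>A. \<forall>g\<in>A. interleaved r f g \<longrightarrow> card {i\<in>{..<r}. f i = g i} \<noteq> l)"

text \<open>Encode \<open>w\<close> by a list of \<open>m\<close> numbers below \<open>X\<close>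
  containing all halves \<open>w j div 2\<close>, and for each \<open>j\<close> a list position and
  a parity.\<close>

lemma card_functions_few_values:
  fixes r m X :: nat
  assumes "0 < r"
  defines "W \<equiv> {w \<in> {..<r} \<rightarrow>\<^sub>E {..<2 * X}. card ((\<lambda>j. w j div 2) ` {..<r}) \<le> m}"
  shows "card W \<le> (2 * m) ^ r * X ^ m"
proof -
  let ?G = "{..<m} \<rightarrow>\<^sub>E {..<X}" and ?H = "{..<r} \<rightarrow>\<^sub>E ({..<m} \<times> {..<2 :: nat})"
  define \<Phi> :: "(nat \<Rightarrow> nat) \<times> (nat \<Rightarrow> nat \<times> nat) \<Rightarrow> nat \<Rightarrow> nat"
    where "\<Phi> = (\<lambda>(g, p). \<lambda>j\<in>{..<r}. 2 * g (fst (p j)) + snd (p j))"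
  have fin: "finite (?G \<times> ?H)" by (intro finite_cartesian_product finite_PiE) auto
  have "W \<subseteq> \<Phi> ` (?G \<times> ?H)"
  proof
    fix w assume "w \<in> W"
    then have w: "w \<in> {..<r} \<rightarrow>\<^sub>E {..<2 * X}" and c: "card ((\<lambda>j. w j div 2) ` {..<r}) \<le> m"
      by (auto simp: W_def)
    define Z where "Z = (\<lambda>j. w j div 2) ` {..<r}"
    have "w j div 2 < X" if "j < r" for j
      using w that by (intro less_mult_imp_div_less) (auto simp: PiE_iff mult.commute)
    then have Z: "finite Z" "Z \<subseteq> {..<X}" by (auto simp: Z_def)
    have "w 0 div 2 \<in> Z" using assms(1) by (auto simp: Z_def)
    obtain h where h: "bij_betw h {0..<card Z} Z" using ex_bij_betw_nat_finite[OF Z(1)] by blast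
    \<comment> \<open>There may be fewer than \<open>m\<close> halves; the list is padded with one
      that is known to lie below \<open>X\<close>.\<close>
    define g where "g = (\<lambda>i\<in>{..<m}. if i < card Z then h i else w 0 div 2)"
    have "h i \<in> Z" if "i < card Z" for i
      using h that by (auto simp: bij_betw_def)
    then have "h i < X" if "i < card Z" for i
      using that Z(2) by blast
    moreover have "w 0 div 2 < X" using \<open>w 0 div 2 \<in> Z\<close> Z(2) by blast
    ultimately have "g \<in> ?G" by (auto simp: g_def)
    define s where "s j = (SOME i. i < card Z \<and> h i = w j div 2)" for j
    have s: "s j < card Z \<and> h (s j) = w j div 2" if "j < r" for j
    proof -
      have "w j div 2 \<in> h ` {0..<card Z}" using that h by (auto simp: bij_betw_def Z_def)
      then have "\<exists>i. i < card Z \<and> h i = w j div 2" by auto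
      then show ?thesis unfolding s_def by (rule someI_ex)
    qed
    have sm: "s j < m" if "j < r" for j using s[OF that] c by (simp add: Z_def)
    define p where "p = (\<lambda>j\<in>{..<r}. (s j, w j mod 2))"
    have "p \<in> ?H" using sm by (auto simp: p_def)
    moreover have "w = \<Phi> (g, p)"
    proof
      fix j show "w j = \<Phi> (g, p) j"
        using s[of j] sm[of j] w by (cases "j < r") (auto simp: \<Phi>_def p_def g_def)
    qed
    ultimately show "w \<in> \<Phi> ` (?G \<times> ?H)" using \<open>g \<in> ?G\<close> by blast
  qed
  then have "card W \<le> card (?G \<times> ?H)"
    using fin by (meson card_image_le card_mono finite_imageI le_trans)
  also have "\<dots> = (2 * m) ^ r * X ^ m"
    by (simp add: card_cartesian_product card_PiE mult.commute)
  finally show ?thesis .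
qed

section \<open>Tuples with a common vector of blocks\<close>

lemma card_image_le_card_jumps:
  fixes w :: "nat \<Rightarrow> nat"
  assumes "mono_on {..<r} w"
  shows "card (w ` {..<r}) \<le> card {j\<in>{..<r}. j = 0 \<or> w (j - 1) < w j}"
proof -
  let ?Q = "{j\<in>{..<r}. j = 0 \<or> w (j - 1) < w j}"
  have "w ` {..<r} \<subseteq> w ` ?Q"
  proof clarify
    fix j assume j: "j < r"
    \<comment> \<open>The first position at which a value occurs is \<open>0\<close> or a
      jump.\<close>
    define i where "i = (LEAST i. w i = w j)"
    have i: "w i = w j" "i \<le> j" unfolding i_def by (rule LeastI[of _ j], simp) (simp add: Least_le)
    have "w (i - 1) < w i" if "i > 0"
    proof -
      have "w (i - 1) \<noteq> w j" using not_less_Least[of "i - 1" "\<lambda>i. w i = w j"] that by (auto simp: i_def)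
      moreover have "w (i - 1) \<le> w i" using assms i j by (intro mono_onD[OF assms]) auto
      ultimately show ?thesis using i by simp
    qed
    then show "w j \<in> w ` ?Q" using i j by (intro image_eqI[of _ _ i]) auto
  qed
  then show ?thesis by (intro surj_card_le) auto
qed

text \<open>Tuples with the same vector \<open>w\<close> of blocks that differ only at first positions of blocks
  are interleaved.\<close>

lemma card_same_blocks_le:
  assumes A: "avoiding_tuples r l n A" and "l < r" "\<alpha> < r" "l \<le> \<alpha>" "2 * r \<le> k + \<alpha> + 1 + l"
    and F: "F = {f\<in>A. k \<le> card ((\<lambda>j. f j div b) ` {..<r}) \<and> (\<lambda>j\<in>{..<r}. f j div b) = w}"
    and b: "0 < b"
  shows "card F \<le> distance_const r * b ^ \<alpha>"
proof (cases "F = {}")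
  case False
  then obtain f where f: "f \<in> F" by blast
  have FA: "F \<subseteq> A" using F by blast
  have pi: "g \<in> {..<r} \<rightarrow>\<^sub>E {..<n}" and sm: "strict_mono_on {..<r} g" if "g \<in> F" for g
    using that FA A by (auto simp: avoiding_tuples_def)
  have w: "w j = g j div b" if "g \<in> F" "j < r" for g j
    using that F by auto
  define Q where "Q = {j\<in>{..<r}. j = 0 \<or> w (j - 1) < w j}"
  have "mono_on {..<r} w"
  proof (rule mono_onI)
    fix i j assume "i \<in> {..<r}" "j \<in> {..<r}" "i \<le> j"
    then show "w i \<le> w j"
      using w[OF f] sm[OF f] by (auto simp: strict_mono_on_leD div_le_mono)
  qed
  then have "card (w ` {..<r}) \<le> card Q" unfolding Q_def by (rule card_image_le_card_jumps)
  moreover have "w ` {..<r} = (\<lambda>j. f j div b) ` {..<r}" using w[OF f] by auto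
  ultimately have kQ: "k \<le> card Q" using f F by auto
  define J where "J j = {w j * b..<(w j + 1) * b}" for j
  have "card F \<le> distance_const (card {..<r}) * b ^ \<alpha>"
  \<comment> \<open>Agreeing in \<open>l\<close> of \<open>r\<close> entries means differing in
    \<open>r - l\<close>. With \<open>k \<le> card Q\<close>, the assumption
    \<open>2 * r \<le> k + \<alpha> + 1 + l\<close> is the size condition on
    \<open>Q\<close>.\<close>
  proof (rule card_le_if_no_distance[where q = "r - l" and Q = Q and J = J])
    show "F \<subseteq> PiE {..<r} J"
    proof
      fix g assume g: "g \<in> F"
      have "g j \<in> J j" if "j < r" for j
        using w[OF g that] b by (auto simp: J_def div_times_less_eq_dividend dividend_less_div_times
            add.commute)
      then show "g \<in> PiE {..<r} J" using pi[OF g] by (auto simp: PiE_iff)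
    qed
    fix g h assume gh: "g \<in> F" "h \<in> F" and sub: "{i. g i \<noteq> h i} \<subseteq> Q"
    \<comment> \<open>At the first position of a block the two entries lie in different blocks;
      elsewhere the tuples agree, and \<open>x\<close> is increasing.\<close>
    have step: "x j < y (Suc j)" if "Suc j < r" "x \<in> F" "y \<in> F" "{i. x i \<noteq> y i} \<subseteq> Q" for x y j
    proof (cases "Suc j \<in> Q")
      case True
      then have "x j div b < y (Suc j) div b" using that w[of x j] w[of y "Suc j"] by (simp add: Q_def)
      then show ?thesis by (meson div_le_mono leD leI)
    next
      case False
      then have "x (Suc j) = y (Suc j)" using that(4) by blast
      then show ?thesis
        using strict_mono_onD[OF sm[OF that(2)], of j "Suc j"] that(1) by simp
    qed
    have lt: "x i < y j" if "i < j" "j < r" "x \<in> F" "y \<in> F" "{i. x i \<noteq> y i} \<subseteq> Q" for x y i j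
    proof -
      have "x i \<le> x (j - 1)" using strict_mono_on_leD[OF sm[OF that(3)], of i "j - 1"] that(1,2) by simp
      also have "\<dots> < y j" using step[of "j - 1" x y] that by simp
      finally show ?thesis .
    qed
    have sub': "{i. h i \<noteq> g i} \<subseteq> Q" using sub by (simp add: eq_commute)
    have "interleaved r g h"
      unfolding interleaved_def using lt gh sub sub' by blast
    then have "card {i\<in>{..<r}. g i = h i} \<noteq> l"
      using A gh FA unfolding avoiding_tuples_def by blast
    moreover have "{i. g i \<noteq> h i} = {..<r} - {i\<in>{..<r}. g i = h i}"
      using sub by (auto simp: Q_def)
    then have "card {i. g i \<noteq> h i} = r - card {i\<in>{..<r}. g i = h i}"
      by (simp only:) (subst card_Diff_subset, auto)
    moreover have "card {i\<in>{..<r}. g i = h i} \<le> r"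
      using card_mono[of "{..<r}" "{i\<in>{..<r}. g i = h i}"] by auto
    ultimately show "card {i. g i \<noteq> h i} \<noteq> r - l" using \<open>l < r\<close> by linarith
  qed (use assms kQ in \<open>auto simp: J_def Q_def\<close>)
  then show ?thesis by simp
qed simp

section \<open>Summation over the dyadic scales\<close>

lemma card_avoiding_tuples_le_sum:
  assumes A: "avoiding_tuples r l n A" and "l < r" "\<alpha> < r" "l \<le> \<alpha>" "2 * r \<le> k + \<alpha> + 1 + l"
    and k: "0 < k" "k \<le> r" and n: "n \<le> 2 ^ L"
  shows "card A \<le> (2 * k) ^ r * distance_const r * (\<Sum>i\<le>L. (2 ^ (L - i)) ^ (k - 1) * (2 ^ i) ^ \<alpha>)"
proof -
  define N where "N f i = card ((\<lambda>j. f j div 2 ^ i) ` {..<r})" for f :: "nat \<Rightarrow> nat" and i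
  define lev where "lev f = Max {i. i \<le> L \<and> k \<le> N f i}" for f
  have pi: "f \<in> {..<r} \<rightarrow>\<^sub>E {..<n}" and sm: "strict_mono_on {..<r} f" if "f \<in> A" for f
    using that A by (auto simp: avoiding_tuples_def)
  have "finite A"
  proof (rule finite_subset)
    show "A \<subseteq> {..<r} \<rightarrow>\<^sub>E {..<n}" using pi by blast
  qed (intro finite_PiE; simp)
  have lev: "lev f \<le> L \<and> k \<le> N f (lev f)" if "f \<in> A" for f
  proof -
    \<comment> \<open>At scale \<open>1\<close> the blocks are single points, so the level
      exists.\<close>
    have "N f 0 = r"
      using sm[OF that] by (simp add: N_def card_image strict_mono_on_imp_inj_on)
    then have "{i. i \<le> L \<and> k \<le> N f i} \<noteq> {}" using k by auto
    then show ?thesis using Max_in[of "{i. i \<le> L \<and> k \<le> N f i}"] by (simp add: lev_def)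
  qed
  have lev_max: "N f (Suc (lev f)) < k" if "lev f < L" for f
  proof (rule ccontr)
    assume "\<not> ?thesis"
    then have "Suc (lev f) \<le> lev f"
      unfolding lev_def by (intro Max_ge) (use that in \<open>auto simp: lev_def\<close>)
    then show False by simp
  qed
  have "card {f\<in>A. lev f = i} \<le>
      (2 * k) ^ r * distance_const r * ((2 ^ (L - i)) ^ (k - 1) * (2 ^ i) ^ \<alpha>)" if i: "i \<le> L" for i
  proof -
    \<comment> \<open>At the top scale all entries lie in block \<open>0\<close>. Below it, fewer
      than \<open>k\<close> blocks are met at the next scale, so the halves of the entries of a
      block vector take at most \<open>k - 1\<close> values.\<close>
    define W :: "(nat \<Rightarrow> nat) set" where "W = (if i = L then {\<lambda>j\<in>{..<r}. 0} else
      {w \<in> {..<r} \<rightarrow>\<^sub>E {..<2 * 2 ^ (L - Suc i)}. card ((\<lambda>j. w j div 2) ` {..<r}) \<le> k - 1})"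
    have finW: "finite W"
    proof (cases "i = L")
      case False
      have "finite ({..<r} \<rightarrow>\<^sub>E {..<2 * 2 ^ (L - Suc i) :: nat})" by (intro finite_PiE) auto
      then show ?thesis using False by (auto simp: W_def)
    qed (simp add: W_def)
    have cW: "card W \<le> (2 * k) ^ r * (2 ^ (L - i)) ^ (k - 1)"
    proof (cases "i = L")
      case True
      then show ?thesis using k by (simp add: W_def)
    next
      case False
      then have "card W \<le> (2 * (k - 1)) ^ r * (2 ^ (L - Suc i)) ^ (k - 1)"
        unfolding W_def using card_functions_few_values[of r "2 ^ (L - Suc i)" "k - 1"] assms(2) by simp
      also have "\<dots> \<le> (2 * k) ^ r * (2 ^ (L - i)) ^ (k - 1)"
        by (intro mult_mono power_mono power_increasing) auto
      finally show ?thesis .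
    qed
    have "card {f\<in>A. lev f = i} \<le> distance_const r * (2 ^ i) ^ \<alpha> * card W"
    proof (rule card_le_if_fibres_le[OF finW])
      show "(\<lambda>f. \<lambda>j\<in>{..<r}. f j div 2 ^ i) ` {f\<in>A. lev f = i} \<subseteq> W"
      proof clarify
        fix f assume f: "f \<in> A" "i = lev f"
        have lt: "f j < 2 ^ L" if "j < r" for j using pi[OF f(1)] that n less_le_trans[of "f j" n] by (auto simp: PiE_iff)
        show "(\<lambda>j\<in>{..<r}. f j div 2 ^ lev f) \<in> W"
        proof (cases "i = L")
          case True
          then show ?thesis using lt f by (auto simp: W_def restrict_def)
        next
          case False
          have e: "2 ^ L = 2 * 2 ^ (L - Suc i) * (2 ^ i :: nat)"
            using i False by (simp flip: power_add power_Suc)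
          have "f j div 2 ^ i < 2 * 2 ^ (L - Suc i)" if "j < r" for j
            using lt[OF that] unfolding e by (rule less_mult_imp_div_less)
          moreover have "(\<lambda>j. (\<lambda>j\<in>{..<r}. f j div 2 ^ i) j div 2) ` {..<r} = (\<lambda>j. f j div 2 ^ Suc i) ` {..<r}"
            by (intro image_cong) (simp_all add: div_mult2_eq[symmetric] mult.commute)
          then have "card ((\<lambda>j. (\<lambda>j\<in>{..<r}. f j div 2 ^ i) j div 2) ` {..<r}) \<le> k - 1"
            using lev_max[of f] i False f by (simp add: N_def)
          ultimately show ?thesis using False f(2) by (auto simp: W_def)
        qed
      qed
      fix w
      have "card {f\<in>{f\<in>A. lev f = i}. (\<lambda>j\<in>{..<r}. f j div 2 ^ i) = w} \<le>
          card {f\<in>A. k \<le> card ((\<lambda>j. f j div 2 ^ i) ` {..<r}) \<and> (\<lambda>j\<in>{..<r}. f j div 2 ^ i) = w}"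
        using lev \<open>finite A\<close> by (intro card_mono) (auto simp: N_def)
      also have "\<dots> \<le> distance_const r * (2 ^ i) ^ \<alpha>"
        by (rule card_same_blocks_le[OF A assms(2-5) refl]) simp
      finally show "card {f\<in>{f\<in>A. lev f = i}. (\<lambda>j\<in>{..<r}. f j div 2 ^ i) = w} \<le>
          distance_const r * (2 ^ i) ^ \<alpha>" .
    qed
    also have "\<dots> \<le> distance_const r * (2 ^ i) ^ \<alpha> * ((2 * k) ^ r * (2 ^ (L - i)) ^ (k - 1))"
      using cW by (rule mult_left_mono) simp
    finally show ?thesis by (simp add: mult_ac)
  qed
  then have "(\<Sum>i\<le>L. card {f\<in>A. lev f = i}) \<le>
      (\<Sum>i\<le>L. (2 * k) ^ r * distance_const r * ((2 ^ (L - i)) ^ (k - 1) * (2 ^ i) ^ \<alpha>))"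
    by (intro sum_mono) simp
  moreover have "card A = (\<Sum>i\<le>L. card {f\<in>A. lev f = i})"
  proof -
    have "card A = card (\<Union>i\<le>L. {f\<in>A. lev f = i})"
      using lev by (intro arg_cong[of _ _ card]) auto
    also have "\<dots> = (\<Sum>i\<le>L. card {f\<in>A. lev f = i})"
      using \<open>finite A\<close> by (intro card_UN_disjoint) auto
    finally show ?thesis .
  qed
  ultimately show ?thesis by (simp add: sum_distrib_left)
qed

text \<open>With \<open>\<beta> = \<alpha> + 1 - k\<close> the \<open>i\<close>-th term is
  \<open>(2 ^ L) ^ (k - 1) * (2 ^ \<beta>) ^ i\<close>. For \<beta> > 0 this is a geometric sum, at
  most twice its last term; for \<beta> = 0 all \<open>L + 1\<close> terms are equal, which is the
  source of the logarithm.\<close>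

lemma geometric_level_sum_le:
  assumes "0 < k" "k \<le> \<alpha> + 1"
  shows "(\<Sum>i\<le>L. (2 ^ (L - i)) ^ (k - 1) * (2 ^ i) ^ \<alpha>) \<le> (if k \<le> \<alpha> then 2 else L + 1) * (2 ^ L :: nat) ^ \<alpha>"
proof -
  define \<beta> where "\<beta> = \<alpha> + 1 - k"
  have \<alpha>: "\<alpha> = (k - 1) + \<beta>" using assms by (simp add: \<beta>_def)
  have "(2 ^ (L - i)) ^ (k - 1) * (2 ^ i) ^ \<alpha> = (2 ^ L) ^ (k - 1) * (2 ^ \<beta> :: nat) ^ i" if "i \<le> L" for i
  proof -
    have "(2 ^ (L - i)) ^ (k - 1) * (2 ^ i) ^ \<alpha> = (2 ^ (L - i) * 2 ^ i) ^ (k - 1) * (2 ^ i :: nat) ^ \<beta>"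
      by (simp add: \<alpha> power_add power_mult_distrib)
    also have "2 ^ (L - i) * 2 ^ i = (2 ^ L :: nat)" using that by (simp flip: power_add)
    finally show ?thesis by (simp add: mult.commute flip: power_mult)
  qed
  then have eq: "(\<Sum>i\<le>L. (2 ^ (L - i)) ^ (k - 1) * (2 ^ i) ^ \<alpha>) =
      (2 ^ L) ^ (k - 1) * (\<Sum>i\<le>L. (2 ^ \<beta> :: nat) ^ i)"
    by (simp add: sum_distrib_left)
  have "(\<Sum>i\<le>L. (2 ^ \<beta> :: nat) ^ i) \<le> (if k \<le> \<alpha> then 2 else L + 1) * (2 ^ L) ^ \<beta>"
  proof (cases "k \<le> \<alpha>")
    case True
    have double: "2 * x \<le> 2 ^ \<beta> * x" for x :: nat
      using True by (intro mult_right_mono) (auto simp: \<beta>_def self_le_power)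
    have "(\<Sum>i\<le>L. (2 ^ \<beta> :: nat) ^ i) \<le> 2 * (2 ^ \<beta>) ^ L"
    proof (induction L)
      case (Suc L)
      then show ?case using double[of "(2 ^ \<beta>) ^ L"]
        unfolding sum.atMost_Suc power_Suc by linarith
    qed simp
    then show ?thesis using True by (simp add: mult.commute flip: power_mult)
  next
    case False
    then have "\<beta> = 0" by (simp add: \<beta>_def)
    then show ?thesis using False by simp
  qed
  then have "(2 ^ L) ^ (k - 1) * (\<Sum>i\<le>L. (2 ^ \<beta>) ^ i) \<le>
      (2 ^ L) ^ (k - 1) * ((if k \<le> \<alpha> then 2 else L + 1) * (2 ^ L :: nat) ^ \<beta>)"
    by (rule mult_left_mono) simp
  also have "\<dots> = (if k \<le> \<alpha> then 2 else L + 1) * ((2 ^ L) ^ (k - 1) * (2 ^ L) ^ \<beta>)"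
    by (simp only: mult.left_commute)
  also have "(2 ^ L) ^ (k - 1) * (2 ^ L :: nat) ^ \<beta> = (2 ^ L) ^ \<alpha>"
    by (subst \<alpha>) (rule power_add[symmetric])
  finally show ?thesis unfolding eq .
qed

lemma card_avoiding_tuples_le:
  assumes A: "avoiding_tuples r l n A" and "l < r" "\<alpha> < r" "l \<le> \<alpha>" "2 * r \<le> k + \<alpha> + 1 + l"
    and k: "0 < k" "k \<le> r" "k \<le> \<alpha> + 1" and n: "2 \<le> n"
  shows "real (card A) \<le> real ((2 * k) ^ r * distance_const r * 2 ^ \<alpha>) *
           ((if k \<le> \<alpha> then 2 else 6 * ln (real n)) * real n ^ \<alpha>)"
proof -
  \<comment> \<open>Rounding \<open>n\<close> up to a power of two loses less than a factor
    \<open>2\<close>, hence the \<open>2 ^ \<alpha>\<close> in the bound.\<close>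
  obtain L where L: "n \<le> 2 ^ L" "2 ^ L < 2 * n"
  proof -
    define L where "L = (LEAST L. n \<le> 2 ^ L)"
    have 1: "n \<le> 2 ^ L" unfolding L_def by (rule LeastI[of _ n]) (simp add: less_imp_le)
    then have "L \<noteq> 0" using n by (intro notI) simp
    then have "\<not> n \<le> 2 ^ (L - 1)" using not_less_Least[of "L - 1" "\<lambda>L. n \<le> 2 ^ L"] by (simp add: L_def)
    moreover have "2 ^ L = 2 * (2 ^ (L - 1) :: nat)" using \<open>L \<noteq> 0\<close> by (simp flip: power_Suc)
    ultimately show ?thesis using that[of L] 1 by simp
  qed
  have "real (2 ^ L) \<le> real (2 * n)" using L(2) by (intro of_nat_mono) simp
  then have "ln (2 ^ L) \<le> ln (2 * real n)" using n by (subst ln_le_cancel_iff) auto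
  then have "real L * ln 2 \<le> ln (2 * real n)" by (simp add: ln_realpow)
  moreover have "ln (2 * real n) = ln 2 + ln (real n)" using n by (simp add: ln_mult)
  moreover have ln2: "ln 2 \<le> ln (real n)" using n by simp
  moreover have half: "1 / 2 \<le> ln (2::real)" using ln_le_minus_one[of "1 / 2 :: real"] by (simp add: ln_div)
  \<comment> \<open>The constant \<open>6\<close> combines \<open>L \<le> 4 * ln n\<close> with
    \<open>1 \<le> 2 * ln n\<close>.\<close>
  ultimately have "real L * (1 / 2) \<le> 2 * ln (real n)"
    using mult_left_mono[OF half, of "real L"] by linarith
  then have "real L + 1 \<le> 6 * ln (real n)" using half ln2 by linarith
  have "card A \<le> (2 * k) ^ r * distance_const r * ((if k \<le> \<alpha> then 2 else L + 1) * (2 ^ L) ^ \<alpha>)"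
    using card_avoiding_tuples_le_sum[OF assms(1-5) k(1,2) L(1)] geometric_level_sum_le[OF k(1,3), of L]
    by (meson le_trans mult_left_mono zero_le)
  also have "\<dots> \<le> (2 * k) ^ r * distance_const r * ((if k \<le> \<alpha> then 2 else L + 1) * (2 * n) ^ \<alpha>)"
    using L by (intro mult_left_mono power_mono) auto
  finally have "real (card A) \<le>
      real ((2 * k) ^ r * distance_const r * ((if k \<le> \<alpha> then 2 else L + 1) * (2 * n) ^ \<alpha>))"
    by (rule of_nat_mono)
  also have "\<dots> = real ((2 * k) ^ r * distance_const r * 2 ^ \<alpha>) *
      ((if k \<le> \<alpha> then 2 else real L + 1) * real n ^ \<alpha>)"
    by (simp add: power_mult_distrib)
  also have "\<dots> \<le> real ((2 * k) ^ r * distance_const r * 2 ^ \<alpha>) *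
      ((if k \<le> \<alpha> then 2 else 6 * ln (real n)) * real n ^ \<alpha>)"
    using \<open>real L + 1 \<le> 6 * ln (real n)\<close> by (intro mult_left_mono mult_right_mono) auto
  finally show ?thesis .
qed

section \<open>Ordered hypergraphs and families of increasing tuples\<close>

lemma ex_strict_mono_enumeration:
  fixes V :: "nat set"
  assumes "finite V"
  shows "\<exists>\<nu>. strict_mono_on {..<card V} \<nu> \<and> \<nu> ` {..<card V} = V"
proof (intro exI conjI)
  let ?\<nu> = "\<lambda>i. sorted_list_of_set V ! i"
  show "strict_mono_on {..<card V} ?\<nu>"
    by (intro strict_mono_onI) (auto intro!: sorted_wrt_nth_less[OF strict_sorted_list_of_set])
  have "?\<nu> ` {..<card V} = set (sorted_list_of_set V)"
    by (auto simp: set_conv_nth)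
  then show "?\<nu> ` {..<card V} = V" using assms by simp
qed

lemma strict_mono_on_image_unique:
  fixes f g :: "nat \<Rightarrow> nat"
  assumes "strict_mono_on {..<r} f" "strict_mono_on {..<r} g" "f ` {..<r} = g ` {..<r}" "i < r"
  shows "f i = g i"
proof -
  have s: "sorted (map h [0..<r]) \<and> distinct (map h [0..<r])" if "strict_mono_on {..<r} h" for h :: "nat \<Rightarrow> nat"
  proof -
    have "inj_on h {..<r}" by (rule strict_mono_on_imp_inj_on[OF that])
    then show ?thesis
      using strict_mono_on_leD[OF that]
      by (auto simp: distinct_map sorted_iff_nth_mono_less atLeast0LessThan)
  qed
  have "map f [0..<r] = map g [0..<r]"
    using s[OF assms(1)] s[OF assms(2)] assms(3)
    by (intro sorted_distinct_set_unique) (auto simp: atLeast0LessThan)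
  then show ?thesis using assms(4) by (auto simp: map_eq_conv)
qed

section \<open>Forbidden configurations as interleaved pairs of tuples\<close>

lemma ord_contains_two_edges_imp:
  assumes "l < r" and G: "G \<in> ord_family r (two_edges r l)" and H: "ord_contains H G"
  shows "\<exists>f g :: nat \<Rightarrow> nat. strict_mono_on {..<r} f \<and> strict_mono_on {..<r} g \<and> interleaved r f g \<and>
    f ` {..<r} \<in> edges H \<and> g ` {..<r} \<in> edges H \<and> card {i\<in>{..<r}. f i = g i} = l"
proof -
  have rG: "rgraph r G" and "interval_partite r G" and "hypergraph_iso G (two_edges r l)"
    using G by (auto simp: ord_family_def)
  obtain I where I: "\<And>j. j \<in> {1..r} \<Longrightarrow> interval_in (verts G) (I j)"
    "\<And>i j x y. i \<in> {1..r} \<Longrightarrow> j \<in> {1..r} \<Longrightarrow> i < j \<Longrightarrow> x \<in> I i \<Longrightarrow> y \<in> I j \<Longrightarrow> x < y"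
    "\<And>e j. e \<in> edges G \<Longrightarrow> j \<in> {1..r} \<Longrightarrow> card (e \<inter> I j) = 1"
    using \<open>interval_partite r G\<close> unfolding interval_partite_def by metis
  obtain \<phi> where \<phi>: "bij_betw \<phi> (verts G) (verts (two_edges r l))"
    "(\<lambda>e. \<phi> ` e) ` edges G = edges (two_edges r l)"
    using \<open>hypergraph_iso G (two_edges r l)\<close> unfolding hypergraph_iso_def by blast
  have "{0..<r} \<in> (\<lambda>e. \<phi> ` e) ` edges G" "{r - l..<2 * r - l} \<in> (\<lambda>e. \<phi> ` e) ` edges G"
    unfolding \<phi>(2) by (auto simp: two_edges_def)
  then obtain e1 e2 where e: "e1 \<in> edges G" "e2 \<in> edges G"
    "\<phi> ` e1 = {0..<r}" "\<phi> ` e2 = {r - l..<2 * r - l}"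
    by (metis imageE)
  have sub: "e1 \<subseteq> verts G" "e2 \<subseteq> verts G" "card e1 = r" "card e2 = r"
    using rG e by (auto simp: rgraph_def)
  have fin: "finite e1" "finite e2" using sub rG finite_subset by (auto simp: rgraph_def)
  have inj\<phi>: "inj_on \<phi> (verts G)" using \<phi> by (simp add: bij_betw_def)
  have "card (e1 \<inter> e2) = card (\<phi> ` (e1 \<inter> e2))"
    using sub by (intro card_image[symmetric] inj_on_subset[OF inj\<phi>]) auto
  also have "\<phi> ` (e1 \<inter> e2) = {0..<r} \<inter> {r - l..<2 * r - l}"
    using inj_on_image_Int[OF inj\<phi> sub(1,2)] e by simp
  finally have cl: "card (e1 \<inter> e2) = l" using two_edges_share(1)[of l r] assms(1) by simp
  \<comment> \<open>The tuple of an edge lists its vertices in the successive intervals; entries are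
    numbered from \<open>0\<close>, intervals from \<open>1\<close>.\<close>
  have "\<exists>u. \<forall>j<r. e \<inter> I (Suc j) = {u j}" if "e \<in> edges G" for e
  proof -
    have "\<forall>j. \<exists>x. j < r \<longrightarrow> e \<inter> I (Suc j) = {x}"
      using I(3)[OF that] by (auto simp: card_1_singleton_iff)
    then show ?thesis by metis
  qed
  then obtain u v where uv: "\<And>j. j < r \<Longrightarrow> e1 \<inter> I (Suc j) = {u j}" "\<And>j. j < r \<Longrightarrow> e2 \<inter> I (Suc j) = {v j}"
    using e(1,2) by meson
  have mem: "u j \<in> e1" "u j \<in> I (Suc j)" "v j \<in> e2" "v j \<in> I (Suc j)" if "j < r" for j
    using uv[OF that] by auto
  have lt: "x < y" if "i < j" "j < r" "x \<in> I (Suc i)" "y \<in> I (Suc j)" for i j x y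
    using I(2)[of "Suc i" "Suc j" x y] that by auto
  have uv_lt: "u i < u j" "v i < v j" "u i < v j" "v i < u j" if "i < j" "j < r" for i j
    using that mem[of i] mem[of j] lt[OF that] by simp_all
  have inj: "inj_on u {..<r}" "inj_on v {..<r}"
    using uv_lt by (auto intro!: strict_mono_on_imp_inj_on strict_mono_onI)
  then have "card (u ` {..<r}) = card e1" "card (v ` {..<r}) = card e2"
    using sub by (simp_all add: card_image)
  then have im: "u ` {..<r} = e1" "v ` {..<r} = e2"
    using mem fin card_subset_eq[of e1 "u ` {..<r}"] card_subset_eq[of e2 "v ` {..<r}"]
    by (simp_all add: image_subset_iff)
  \<comment> \<open>Entries at different positions are strictly ordered, even across the two edges,
    so a common vertex has the same position in both.\<close>
  have "u ` {i\<in>{..<r}. u i = v i} = e1 \<inter> e2"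
  proof
    show "u ` {i\<in>{..<r}. u i = v i} \<subseteq> e1 \<inter> e2"
    proof
      fix x assume "x \<in> u ` {i\<in>{..<r}. u i = v i}"
      then obtain i where "i < r" "x = u i" "x = v i" by auto
      then show "x \<in> e1 \<inter> e2" using mem[of i] by simp
    qed
    show "e1 \<inter> e2 \<subseteq> u ` {i\<in>{..<r}. u i = v i}"
    proof
      fix x assume x: "x \<in> e1 \<inter> e2"
      then obtain i j where ij: "i < r" "j < r" "x = u i" "x = v j" using im by blast
      then have "i = j" using uv_lt(3)[of i j] uv_lt(4)[of j i]
        by (metis less_irrefl linorder_neqE_nat)
      then show "x \<in> u ` {i\<in>{..<r}. u i = v i}" using ij by blast
    qed
  qed
  then have cuv: "card {i\<in>{..<r}. u i = v i} = l"
    using cl inj(1) card_image[of u "{i\<in>{..<r}. u i = v i}"] by (auto simp: inj_on_def)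
  obtain \<psi> where \<psi>: "inj_on \<psi> (verts G)" "mono_on (verts G) \<psi>" "\<And>e. e \<in> edges G \<Longrightarrow> \<psi> ` e \<in> edges H"
    using H unfolding ord_contains_def by blast
  have \<psi>lt: "\<psi> x < \<psi> y" if "x < y" "x \<in> verts G" "y \<in> verts G" for x y
    using \<psi> that by (metis inj_onD less_imp_le less_le mono_onD less_irrefl)
  have V: "u j \<in> verts G" "v j \<in> verts G" if "j < r" for j using mem[OF that] sub by auto
  have "strict_mono_on {..<r} (\<psi> \<circ> u)" "strict_mono_on {..<r} (\<psi> \<circ> v)"
    using V uv_lt by (auto intro!: strict_mono_onI \<psi>lt)
  moreover have "interleaved r (\<psi> \<circ> u) (\<psi> \<circ> v)"
    using V uv_lt by (auto simp: interleaved_def intro!: \<psi>lt)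
  moreover have "(\<psi> \<circ> u) ` {..<r} \<in> edges H" "(\<psi> \<circ> v) ` {..<r} \<in> edges H"
    unfolding image_comp[symmetric] im using \<psi>(3) e by auto
  moreover have "{i\<in>{..<r}. (\<psi> \<circ> u) i = (\<psi> \<circ> v) i} = {i\<in>{..<r}. u i = v i}"
    using V \<psi>(1) by (auto dest: inj_onD)
  then have "card {i\<in>{..<r}. (\<psi> \<circ> u) i = (\<psi> \<circ> v) i} = l" using cuv by simp
  ultimately show ?thesis by blast
qed

text \<open>Bijections on \<open>e1 - e2\<close>, \<open>e1 \<inter> e2\<close> and
  \<open>e2 - e1\<close> are glued; each edge is the union of two of these pieces.\<close>

lemma hypergraph_iso_two_edges:
  assumes "finite e1" "finite e2" "card e1 = r" "card e2 = r" "card (e1 \<inter> e2) = l"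
  shows "hypergraph_iso (e1 \<union> e2, {e1, e2}) (two_edges r l)"
proof -
  have "l \<le> r" using assms by (metis Int_lower1 card_mono)
  have c: "card (e1 - e2) = r - l" "card (e2 - e1) = r - l"
    using assms by (metis card_Diff_subset_Int finite_Int Int_commute)+
  obtain f1 where f1: "bij_betw f1 (e1 - e2) {0..<r - l}"
    using finite_same_card_bij[of "e1 - e2" "{0..<r - l}"] assms c by auto
  obtain f2 where f2: "bij_betw f2 (e1 \<inter> e2) {r - l..<r}"
    using finite_same_card_bij[of "e1 \<inter> e2" "{r - l..<r}"] assms \<open>l \<le> r\<close> by auto
  obtain f3 where f3: "bij_betw f3 (e2 - e1) {r..<2 * r - l}"
    using finite_same_card_bij[of "e2 - e1" "{r..<2 * r - l}"] assms c \<open>l \<le> r\<close> by auto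
  define f where "f x = (if x \<in> e1 - e2 then f1 x else if x \<in> e1 \<inter> e2 then f2 x else f3 x)" for x
  have b1: "bij_betw f (e1 - e2) {0..<r - l}" by (rule bij_betw_cong[THEN iffD1, OF _ f1]) (simp add: f_def)
  have b2: "bij_betw f (e1 \<inter> e2) {r - l..<r}" by (rule bij_betw_cong[THEN iffD1, OF _ f2]) (simp add: f_def)
  have b3: "bij_betw f (e2 - e1) {r..<2 * r - l}" by (rule bij_betw_cong[THEN iffD1, OF _ f3]) (simp add: f_def)
  have "bij_betw f ((e1 - e2) \<union> (e1 \<inter> e2)) ({0..<r - l} \<union> {r - l..<r})"
    by (rule bij_betw_combine[OF b1 b2]) auto
  moreover have "(e1 - e2) \<union> (e1 \<inter> e2) = e1" "{0..<r - l} \<union> {r - l..<r} = {0..<r}" by auto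
  ultimately have B1: "bij_betw f e1 {0..<r}" by simp
  have "bij_betw f ((e1 \<inter> e2) \<union> (e2 - e1)) ({r - l..<r} \<union> {r..<2 * r - l})"
    by (rule bij_betw_combine[OF b2 b3]) auto
  moreover have "(e1 \<inter> e2) \<union> (e2 - e1) = e2" "{r - l..<r} \<union> {r..<2 * r - l} = {r - l..<2 * r - l}"
    using \<open>l \<le> r\<close> by auto
  ultimately have B2: "bij_betw f e2 {r - l..<2 * r - l}" by simp
  have "bij_betw f (e1 \<union> (e2 - e1)) ({0..<r} \<union> {r..<2 * r - l})"
    by (rule bij_betw_combine[OF B1 b3]) auto
  moreover have "e1 \<union> (e2 - e1) = e1 \<union> e2" "{0..<r} \<union> {r..<2 * r - l} = {0..<2 * r - l}"
    using \<open>l \<le> r\<close> by auto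
  ultimately have "bij_betw f (e1 \<union> e2) {0..<2 * r - l}" by simp
  moreover have "f ` e1 = {0..<r}" "f ` e2 = {r - l..<2 * r - l}"
    using B1 B2 by (auto simp: bij_betw_def)
  ultimately show ?thesis
    unfolding hypergraph_iso_def two_edges_def by (intro exI[of _ f]) simp
qed

text \<open>The two edges themselves form the contained member, embedded by the identity. Its
  interval number \<open>j + 1\<close> consists of the vertices between \<open>f j\<close> and
  \<open>g j\<close>; interleaving puts these intervals in order.\<close>

lemma interleaved_imp_ord_contains:
  assumes H: "rgraph r H" and f: "strict_mono_on {..<r} f" and g: "strict_mono_on {..<r} g"
    and fg: "interleaved r f g" and e: "f ` {..<r} \<in> edges H" "g ` {..<r} \<in> edges H"
    and l: "card {i\<in>{..<r}. f i = g i} = l"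
  shows "\<exists>G\<in>ord_family r (two_edges r l). ord_contains H G"
proof -
  define G where "G = (f ` {..<r} \<union> g ` {..<r}, {f ` {..<r}, g ` {..<r}})"
  have inj: "inj_on f {..<r}" "inj_on g {..<r}" using f g by (auto intro: strict_mono_on_imp_inj_on)
  have card: "card (f ` {..<r}) = r" "card (g ` {..<r}) = r" using inj by (simp_all add: card_image)
  have lt: "f i < f j" "g i < g j" "f i < g j" "g i < f j" if "i < j" "j < r" for i j
    using that f g fg by (auto simp: interleaved_def strict_mono_on_def)
  have "f ` {i\<in>{..<r}. f i = g i} = f ` {..<r} \<inter> g ` {..<r}"
  proof
    show "f ` {..<r} \<inter> g ` {..<r} \<subseteq> f ` {i\<in>{..<r}. f i = g i}"
    proof
      fix x assume "x \<in> f ` {..<r} \<inter> g ` {..<r}"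
      then obtain i j where ij: "i < r" "j < r" "x = f i" "x = g j" by blast
      then have "i = j" using lt(3)[of i j] lt(4)[of j i] by (metis less_irrefl linorder_neqE_nat)
      then show "x \<in> f ` {i\<in>{..<r}. f i = g i}" using ij by blast
    qed
    show "f ` {i\<in>{..<r}. f i = g i} \<subseteq> f ` {..<r} \<inter> g ` {..<r}" by force
  qed
  then have cl: "card (f ` {..<r} \<inter> g ` {..<r}) = l"
    using l inj card_image[of f "{i\<in>{..<r}. f i = g i}"] by (auto simp: inj_on_def)
  have "hypergraph_iso G (two_edges r l)"
    unfolding G_def using card cl by (intro hypergraph_iso_two_edges) auto
  moreover have "rgraph r G" using card by (auto simp: rgraph_def G_def)
  moreover have "interval_partite r G"
  proof -
    define lo where "lo j = min (f j) (g j)" for j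
    define hi where "hi j = max (f j) (g j)" for j
    define I where "I j = {x\<in>verts G. lo (j - 1) \<le> x \<and> x \<le> hi (j - 1)}" for j
    have lohi: "hi i < lo j" if "i < j" "j < r" for i j using lt[OF that] by (simp add: lo_def hi_def)
    have fI: "f ` {..<r} \<inter> I (Suc j) = {f j}" "g ` {..<r} \<inter> I (Suc j) = {g j}" if "j < r" for j
    proof -
      have b: "lo i \<le> f i" "f i \<le> hi i" "lo i \<le> g i" "g i \<le> hi i" for i by (auto simp: lo_def hi_def)
      have eq: "i = j" if "i < r" "lo j \<le> x" "x \<le> hi j" "lo i \<le> x" "x \<le> hi i" for i x
        using lohi[of i j] lohi[of j i] that \<open>j < r\<close> by (cases i j rule: linorder_cases) auto
      have "i = j" if "i < r" "f i \<in> I (Suc j) \<or> g i \<in> I (Suc j)" for i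
        using eq[of i "f i"] eq[of i "g i"] b[of i] that by (auto simp: I_def)
      moreover have "f j \<in> I (Suc j)" "g j \<in> I (Suc j)"
        using b[of j] \<open>j < r\<close> by (simp_all add: I_def G_def)
      ultimately show "f ` {..<r} \<inter> I (Suc j) = {f j}" "g ` {..<r} \<inter> I (Suc j) = {g j}"
        using \<open>j < r\<close> by blast+
    qed
    have "interval_in (verts G) (I j)" for j by (auto simp: interval_in_def I_def)
    moreover have "x < y" if "i \<in> {1..r}" "j \<in> {1..r}" "i < j" "x \<in> I i" "y \<in> I j" for i j x y
    proof -
      have "hi (i - 1) < lo (j - 1)" using that by (intro lohi) auto
      then show ?thesis using that(4,5) by (simp add: I_def)
    qed
    moreover have "card (e \<inter> I j) = 1" if "e \<in> edges G" "j \<in> {1..r}" for e j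
      using fI[of "j - 1"] that by (auto simp: G_def)
    ultimately show ?thesis unfolding interval_partite_def by blast
  qed
  ultimately have "G \<in> ord_family r (two_edges r l)" by (simp add: ord_family_def)
  moreover have "ord_contains H G"
    unfolding ord_contains_def using H e by (intro exI[of _ id]) (auto simp: G_def rgraph_def mono_on_def)
  ultimately show ?thesis by blast
qed

section \<open>Extremal numbers as sizes of families of tuples\<close>

lemma card_le_ex_ord:
  assumes "l < r" and A: "avoiding_tuples r l n A"
  shows "card A \<le> ex_ord r n (ord_family r (two_edges r l))"
proof -
  define H where "H = ({..<n}, (\<lambda>f. f ` {..<r}) ` A)"
  have pi: "f \<in> {..<r} \<rightarrow>\<^sub>E {..<n}" and sm: "strict_mono_on {..<r} f" if "f \<in> A" for f
    using that A by (auto simp: avoiding_tuples_def)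
  have "f = g" if "f \<in> A" "g \<in> A" "f ` {..<r} = g ` {..<r}" for f g
    using strict_mono_on_image_unique[OF sm[OF that(1)] sm[OF that(2)] that(3)] pi that
    by (intro PiE_ext[of f "{..<r}" "\<lambda>_. {..<n}" g]) auto
  then have "card (edges H) = card A" by (auto simp: H_def inj_on_def intro!: card_image)
  moreover have "rgraph r H"
    using pi sm by (fastforce simp: rgraph_def H_def card_image strict_mono_on_imp_inj_on)
  moreover have "\<not> ord_contains H G" if G: "G \<in> ord_family r (two_edges r l)" for G
  proof
    assume "ord_contains H G"
    then obtain f g where fg: "strict_mono_on {..<r} f" "strict_mono_on {..<r} g" "interleaved r f g"
      "f ` {..<r} \<in> edges H" "g ` {..<r} \<in> edges H" "card {i\<in>{..<r}. f i = g i} = l"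
      using ord_contains_two_edges_imp[OF assms(1) G] by blast
    obtain f' g' where fg': "f' \<in> A" "g' \<in> A" "f ` {..<r} = f' ` {..<r}" "g ` {..<r} = g' ` {..<r}"
      using fg(4,5) by (auto simp: H_def)
    \<comment> \<open>An edge has only one increasing enumeration.\<close>
    have eq: "f i = f' i" "g i = g' i" if "i < r" for i
      using strict_mono_on_image_unique fg(1,2) fg' sm that by blast+
    then have "interleaved r f' g'" using fg(3) by (simp add: interleaved_def)
    moreover have "{i\<in>{..<r}. f i = g i} = {i\<in>{..<r}. f' i = g' i}" using eq by auto
    ultimately show False using fg(6) fg' A by (auto simp: avoiding_tuples_def)
  qed
  moreover have "card (verts H) = n" by (simp add: H_def)
  ultimately have "card A \<in> {card (edges H) | H :: nat hypergraph. rgraph r H \<and> card (verts H) = n \<and>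
      (\<forall>G\<in>ord_family r (two_edges r l). \<not> ord_contains H G)}"
    unfolding mem_Collect_eq by (intro exI[of _ H] conjI ballI) simp_all
  then show ?thesis unfolding ex_ord_def by (intro Max_ge ex_ord_finite)
qed

text \<open>The vertex set of an extremal hypergraph is pulled back to \<open>{..<n}\<close> along
  its increasing enumeration \<nu>, which preserves interleaving and the number of
  agreements.\<close>

lemma ex_avoiding_tuples_ex_ord_le:
  "\<exists>A. avoiding_tuples r l n A \<and> ex_ord r n (ord_family r (two_edges r l)) \<le> card A"
proof -
  have "ex_ord r n (ord_family r (two_edges r l)) \<in> {card (edges H) | H :: nat hypergraph. rgraph r H \<and>
      card (verts H) = n \<and> (\<forall>G\<in>ord_family r (two_edges r l). \<not> ord_contains H G)}"
    unfolding ex_ord_def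
    by (intro Max_in ex_ord_finite ex_ord_nonempty ord_family_two_edges_nonempty_edges)
  then obtain H :: "nat hypergraph" where H: "rgraph r H" "card (verts H) = n"
    "\<And>G. G \<in> ord_family r (two_edges r l) \<Longrightarrow> \<not> ord_contains H G"
    and ex: "ex_ord r n (ord_family r (two_edges r l)) = card (edges H)" by blast
  have "finite (verts H)" using H by (simp add: rgraph_def)
  then obtain \<nu> where \<nu>: "strict_mono_on {..<n} \<nu>" "\<nu> ` {..<n} = verts H"
    using ex_strict_mono_enumeration[of "verts H"] H by auto
  define A where "A = {f \<in> {..<r} \<rightarrow>\<^sub>E {..<n}. strict_mono_on {..<r} f \<and> (\<nu> \<circ> f) ` {..<r} \<in> edges H}"
  have "finite A"
  proof (rule finite_subset)
    show "A \<subseteq> {..<r} \<rightarrow>\<^sub>E {..<n}" by (auto simp: A_def)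
  qed (intro finite_PiE; simp)
  have "avoiding_tuples r l n A"
    unfolding avoiding_tuples_def
  proof (intro conjI ballI impI notI)
    show "A \<subseteq> {f \<in> {..<r} \<rightarrow>\<^sub>E {..<n}. strict_mono_on {..<r} f}" by (auto simp: A_def)
    fix f g assume fg: "f \<in> A" "g \<in> A" "interleaved r f g" and l: "card {i\<in>{..<r}. f i = g i} = l"
    have lt: "f i < n" "g i < n" if "i < r" for i using fg that by (auto simp: A_def PiE_iff)
    have "strict_mono_on {..<r} (\<nu> \<circ> f)" "strict_mono_on {..<r} (\<nu> \<circ> g)"
      using fg lt \<nu>(1) by (auto simp: A_def strict_mono_on_def)
    moreover have "interleaved r (\<nu> \<circ> f) (\<nu> \<circ> g)"
      using fg lt \<nu>(1) by (auto simp: interleaved_def strict_mono_on_def)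
    moreover have "{i\<in>{..<r}. (\<nu> \<circ> f) i = (\<nu> \<circ> g) i} = {i\<in>{..<r}. f i = g i}"
      using lt strict_mono_on_imp_inj_on[OF \<nu>(1)] by (auto simp: inj_on_def)
    ultimately show False
      using interleaved_imp_ord_contains[of r H "\<nu> \<circ> f" "\<nu> \<circ> g" l] H fg l by (auto simp: A_def)
  qed
  moreover have "edges H \<subseteq> (\<lambda>f. (\<nu> \<circ> f) ` {..<r}) ` A"
  proof
    fix e assume e: "e \<in> edges H"
    \<comment> \<open>The ranks of the vertices of \<open>e\<close>; their increasing enumeration is
      the tuple sought.\<close>
    define p where "p = {i\<in>{..<n}. \<nu> i \<in> e}"
    have "e \<subseteq> verts H" "card e = r" using e H by (auto simp: rgraph_def)
    have im: "\<nu> ` p = e" using \<open>e \<subseteq> verts H\<close> \<nu>(2) by (auto simp: p_def)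
    have "inj_on \<nu> p" using strict_mono_on_imp_inj_on[OF \<nu>(1)] by (auto simp: p_def inj_on_def)
    then have cp: "card p = r" using im \<open>card e = r\<close> card_image by metis
    have "finite p" by (simp add: p_def)
    then obtain f where f: "strict_mono_on {..<r} f" "f ` {..<r} = p"
      using ex_strict_mono_enumeration[of p] cp by auto
    define f' where "f' = restrict f {..<r}"
    have eq: "f' i = f i" if "i < r" for i using that by (simp add: f'_def)
    have im': "(\<nu> \<circ> f') ` {..<r} = e" using eq f(2) im by (auto simp: image_image cong: image_cong_simp) 
    have "f' \<in> {..<r} \<rightarrow>\<^sub>E {..<n}" using f(2) by (auto simp: f'_def p_def)
    moreover have "strict_mono_on {..<r} f'" using f(1) eq by (auto simp: strict_mono_on_def)
    ultimately have "f' \<in> A" using im' e by (simp add: A_def)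
    then show "e \<in> (\<lambda>f. (\<nu> \<circ> f) ` {..<r}) ` A" using im' by blast
  qed
  then have "card (edges H) \<le> card A" using \<open>finite A\<close> by (rule surj_card_le[rotated])
  ultimately show ?thesis using ex by auto
qed

section \<open>Lower bounds\<close>

text \<open>The difference is a nonzero real polynomial of degree less than \<open>l\<close>, so it
  has at most \<open>l - 1\<close> roots.\<close>

lemma polynomial_agreements_less:
  fixes c c' :: "nat \<Rightarrow> nat"
  assumes "c \<in> {..<l} \<rightarrow>\<^sub>E {..<M}" "c' \<in> {..<l} \<rightarrow>\<^sub>E {..<M}" "c \<noteq> c'"
  shows "card {j\<in>{..<r}. (\<Sum>i<l. c i * j ^ i) = (\<Sum>i<l. c' i * j ^ i)} < l"
proof -
  obtain k where k: "k < l" "c k \<noteq> c' k"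
    using assms PiE_ext[of c "{..<l}" "\<lambda>_. {..<M}" c'] by auto
  define d where "d i = real (c i) - real (c' i)" for i
  let ?Z = "{z. (\<Sum>i\<le>l - 1. d i * z ^ i) = 0}"
  have Z: "finite ?Z" "card ?Z \<le> l - 1"
    using polyfun_rootbound[of d k "l - 1"] k by (auto simp: d_def)
  have l: "{..l - 1} = {..<l}" using k by auto
  have "real ` {j\<in>{..<r}. (\<Sum>i<l. c i * j ^ i) = (\<Sum>i<l. c' i * j ^ i)} \<subseteq> ?Z"
  proof clarify
    fix j assume "(\<Sum>i<l. c i * j ^ i) = (\<Sum>i<l. c' i * j ^ i)"
    then have "real (\<Sum>i<l. c i * j ^ i) = real (\<Sum>i<l. c' i * j ^ i)" by simp
    then show "(\<Sum>i\<le>l - 1. d i * real j ^ i) = 0"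
      unfolding l d_def by (simp add: left_diff_distrib sum_subtractf)
  qed
  then have "card (real ` {j\<in>{..<r}. (\<Sum>i<l. c i * j ^ i) = (\<Sum>i<l. c' i * j ^ i)}) \<le> l - 1"
    by (rule order_trans[OF card_mono[OF Z(1)] Z(2)])
  moreover have "inj_on real X" for X by (simp add: inj_on_def)
  ultimately show ?thesis using k by (simp add: card_image)
qed

text \<open>The tuples list the values at \<open>0, \<dots>, r - 1\<close> of the polynomials of degree less than \<open>l\<close> with
  coefficients below \<open>M\<close>, shifted into consecutive blocks of length \<open>l * M * r ^ l\<close>.\<close>

lemma ex_avoiding_tuples_polynomials:
  assumes "0 < l" "l < r" and n: "r * (l * M * r ^ l) \<le> n"
  shows "\<exists>A. avoiding_tuples r l n A \<and> card A = M ^ l"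
proof -
  let ?C = "{..<l} \<rightarrow>\<^sub>E {..<M}"
  define m where "m = l * M * r ^ l"
  define p where "p c j = (\<Sum>i<l. c i * j ^ i)" for c :: "nat \<Rightarrow> nat" and j
  define t where "t c = (\<lambda>j\<in>{..<r}. j * m + p c j)" for c
  have pm: "p c j < m" if c: "c \<in> ?C" and j: "j < r" for c j
  proof -
    have "c i * j ^ i < M * r ^ l" if "i < l" for i
    proof -
      have "c i < M" using c that by (auto simp: PiE_iff)
      moreover have "j ^ i \<le> r ^ i" using j by (intro power_mono) auto
      moreover have "r ^ i \<le> r ^ l" using that j by (intro power_increasing) auto
      moreover have "0 < r ^ l" using j by simp
      ultimately show ?thesis
        by (meson le_trans mult_le_mono2 mult_strict_right_mono order_le_less_trans)
    qed
    then have "p c j < (\<Sum>i<l. M * r ^ l)"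
      unfolding p_def using assms(1) by (intro sum_strict_mono) auto
    then show ?thesis by (simp add: m_def mult.assoc)
  qed
  have agree: "{j\<in>{..<r}. t c j = t c' j} = {j\<in>{..<r}. p c j = p c' j}" for c c'
    by (auto simp: t_def)
  \<comment> \<open>Distinct tuples agree in fewer than \<open>l\<close> entries, equal ones in
    \<open>r > l\<close>; the value \<open>l\<close> never occurs, interleaved or not.\<close>
  have less: "card {j\<in>{..<r}. t c j = t c' j} < l" if "c \<in> ?C" "c' \<in> ?C" "c \<noteq> c'" for c c'
    unfolding agree p_def using that by (rule polynomial_agreements_less)
  have block: "t c i < Suc i * m" if "c \<in> ?C" "i < r" for c i
    using pm[OF that] that by (simp add: t_def)
  have "avoiding_tuples r l n (t ` ?C)"
    unfolding avoiding_tuples_def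
  proof (intro conjI ballI impI)
    show "t ` ?C \<subseteq> {f \<in> {..<r} \<rightarrow>\<^sub>E {..<n}. strict_mono_on {..<r} f}"
    proof clarify
      fix c assume c: "c \<in> ?C"
      have "t c j < n" if "j < r" for j
      proof -
        have "t c j < Suc j * m" by (rule block[OF c that])
        also have "\<dots> \<le> r * m" using that by (intro mult_right_mono) auto
        finally show ?thesis using n by (simp add: m_def)
      qed
      then have "t c \<in> {..<r} \<rightarrow>\<^sub>E {..<n}" by (auto simp: PiE_iff) (simp add: t_def)
      moreover have "strict_mono_on {..<r} (t c)"
      proof (rule strict_mono_onI)
        fix i j assume ij: "i \<in> {..<r}" "j \<in> {..<r}" "i < j"
        then have "t c i < Suc i * m" using c by (intro block) auto
        also have "\<dots> \<le> j * m" using ij by (intro mult_right_mono) auto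
        also have "\<dots> \<le> t c j" using ij by (simp add: t_def)
        finally show "t c i < t c j" .
      qed
      ultimately show "t c \<in> {..<r} \<rightarrow>\<^sub>E {..<n} \<and> strict_mono_on {..<r} (t c)" ..
    qed
    fix f g assume "f \<in> t ` ?C" "g \<in> t ` ?C"
    then obtain c c' where c: "c \<in> ?C" "c' \<in> ?C" "f = t c" "g = t c'" by blast
    show "card {i\<in>{..<r}. f i = g i} \<noteq> l"
      using less[of c c'] c assms(2) by (cases "c = c'") auto
  qed
  moreover have "inj_on t ?C"
  proof (rule inj_onI, rule ccontr)
    fix c c' assume "c \<in> ?C" "c' \<in> ?C" "t c = t c'" "c \<noteq> c'"
    then show False using less[of c c'] assms(2) by simp
  qed
  then have "card (t ` ?C) = M ^ l" by (simp add: card_image card_PiE)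
  ultimately show ?thesis by blast
qed

text \<open>The first \<open>2 * k\<close> entries form \<open>k\<close> pairs \<open>2 * y, 2 * y + 1\<close>. Interleaved tuples agree on
  every such pair, hence in more than \<open>l\<close> entries.\<close>

lemma ex_avoiding_tuples_pairs:
  assumes "2 * k \<le> r" "l < 2 * k" and n: "2 * ((r - k) * m) \<le> n"
  shows "\<exists>A. avoiding_tuples r l n A \<and> card A = m ^ (r - k)"
proof -
  define s where "s = r - k"
  \<comment> \<open>The two positions of a pair share a slot and every later position has its own,
    which gives \<open>k + (r - 2 * k) = r - k\<close> slots.\<close>
  define slot where "slot j = (if j < 2 * k then j div 2 else j - k)" for j
  \<comment> \<open>Consecutive disjoint ranges for the slots force \<open>y\<close> to be
    increasing while all choices stay independent.\<close>
  define Y where "Y = PiE {..<s} (\<lambda>i. {i * m..<Suc i * m})"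
  define t where "t y = (\<lambda>j\<in>{..<r}. 2 * y (slot j) + (if j < 2 * k then j mod 2 else 0))"
    for y :: "nat \<Rightarrow> nat"
  have slot: "slot j < s" if "j < r" for j using that assms by (auto simp: slot_def s_def)
  have y: "i * m \<le> y i" "y i < Suc i * m" if "y \<in> Y" "i < s" for y i
    using that by (auto simp: Y_def PiE_iff)
  have y_mono: "y i < y j" if "y \<in> Y" "i < j" "j < s" for y i j
  proof -
    have "y i < Suc i * m" using that y by simp
    also have "\<dots> \<le> j * m" using that by (intro mult_right_mono) auto
    also have "\<dots> \<le> y j" using that y by simp
    finally show ?thesis .
  qed
  have slot_mono: "slot i < slot j \<or> slot i = slot j \<and> j < 2 * k \<and> i mod 2 < j mod 2"
    if "i < j" for i j
  proof (cases "j < 2 * k")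
    case True
    have "i div 2 \<le> j div 2" using that by (intro div_le_mono) simp
    moreover have "i = 2 * (i div 2) + i mod 2" "j = 2 * (j div 2) + j mod 2" by simp_all
    ultimately have "i div 2 < j div 2 \<or> i div 2 = j div 2 \<and> i mod 2 < j mod 2"
      using that by linarith
    then show ?thesis using that True by (simp add: slot_def)
  next
    case False
    then show ?thesis using that by (auto simp: slot_def)
  qed
  have sm: "strict_mono_on {..<r} (t y)" if "y \<in> Y" for y
  proof (rule strict_mono_onI)
    fix i j assume ij: "i \<in> {..<r}" "j \<in> {..<r}" "i < j"
    from slot_mono[OF ij(3)] show "t y i < t y j"
    proof
      assume "slot i < slot j"
      then have "y (slot i) < y (slot j)" by (rule y_mono[OF that]) (use slot[of j] ij in simp)
      moreover have "(if i < 2 * k then i mod 2 else 0) \<le> 1" by presburger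
      ultimately show ?thesis using ij unfolding t_def by simp
    next
      assume "slot i = slot j \<and> j < 2 * k \<and> i mod 2 < j mod 2"
      then show ?thesis using ij by (simp add: t_def)
    qed
  qed
  have tn: "t y j < n" if "y \<in> Y" "j < r" for y j
  proof -
    have "y (slot j) < Suc (slot j) * m" using that slot y by blast
    also have "\<dots> \<le> s * m" using slot[OF that(2)] by (intro mult_right_mono) auto
    finally have "2 * y (slot j) + 1 < n" using n by (simp add: s_def)
    then show ?thesis using that by (auto simp: t_def split: if_splits)
  qed
  have even_entry: "t y (2 * i) = 2 * y i" "t y (Suc (2 * i)) = Suc (2 * y i)" if "i < k" for y i
    using that assms by (auto simp: t_def slot_def)
  have "avoiding_tuples r l n (t ` Y)"
    unfolding avoiding_tuples_def
  proof (intro conjI ballI impI)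
    show "t ` Y \<subseteq> {f \<in> {..<r} \<rightarrow>\<^sub>E {..<n}. strict_mono_on {..<r} f}"
    proof clarify
      fix y assume "y \<in> Y"
      then have "t y \<in> {..<r} \<rightarrow>\<^sub>E {..<n}" using tn by (auto simp: PiE_iff) (simp add: t_def)
      then show "t y \<in> {..<r} \<rightarrow>\<^sub>E {..<n} \<and> strict_mono_on {..<r} (t y)" using sm[OF \<open>y \<in> Y\<close>] by simp
    qed
    fix f g assume "f \<in> t ` Y" "g \<in> t ` Y" and inter: "interleaved r f g"
    then obtain y z where yz: "f = t y" "g = t z" by blast
    \<comment> \<open>Interleaving gives \<open>2 * y i < 2 * z i + 1\<close> and the same with
      \<open>y\<close> and \<open>z\<close> exchanged.\<close>
    have "y i = z i" if "i < k" for i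
    proof -
      have "t y (2 * i) < t z (Suc (2 * i))" "t z (2 * i) < t y (Suc (2 * i))"
        using inter that assms unfolding interleaved_def yz by auto
      then show ?thesis using even_entry[OF that] by simp
    qed
    then have "{..<2 * k} \<subseteq> {i\<in>{..<r}. f i = g i}"
      using assms by (auto simp: yz t_def slot_def)
    then have "card {..<2 * k} \<le> card {i\<in>{..<r}. f i = g i}" by (intro card_mono) auto
    then show "card {i\<in>{..<r}. f i = g i} \<noteq> l" using assms by simp
  qed
  moreover have "inj_on t Y"
  proof (rule inj_onI)
    fix y z assume yz: "y \<in> Y" "z \<in> Y" "t y = t z"
    have "y i = z i" if "i < s" for i
    proof (cases "i < k")
      case True
      then show ?thesis using even_entry(1)[OF True, of y] even_entry(1)[OF True, of z] yz by simp
    next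
      case False
      then have "t x (i + k) = 2 * x i" for x using that by (auto simp: t_def slot_def s_def)
      then show ?thesis using yz by (metis mult_cancel1 zero_neq_numeral)
    qed
    then show "y = z" using yz unfolding Y_def by (intro PiE_ext[of y _ _ z]) auto
  qed
  then have "card (t ` Y) = m ^ s" by (simp add: card_image Y_def card_PiE)
  ultimately show ?thesis by (auto simp: s_def)
qed

section \<open>Passage to asymptotic bounds\<close>

lemma power_in_bigo_if_power_div_le:
  fixes f :: "nat \<Rightarrow> nat"
  assumes "0 < K" "\<And>n. (n div K) ^ a \<le> f n"
  shows "(\<lambda>n. real n ^ a) \<in> O(\<lambda>n. real (f n))"
proof (rule bigoI)
  show "\<forall>\<^sub>F n in at_top. norm (real n ^ a) \<le> real ((2 * K) ^ a) * norm (real (f n))"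
    using eventually_ge_at_top[of K]
  proof eventually_elim
    case (elim n)
    then have "1 \<le> n div K" using assms(1) by (simp add: div_greater_zero_iff Suc_le_eq)
    then have "K * 1 \<le> K * (n div K)" by (rule mult_left_mono) simp
    \<comment> \<open>The remainder is below \<open>K\<close>, hence below
      \<open>K * (n div K)\<close> or equal to it at most, so rounding down costs at most a factor
      \<open>2\<close>.\<close>
    moreover have "n = K * (n div K) + n mod K" "n mod K < K" using assms(1) by simp_all
    ultimately have "n \<le> 2 * K * (n div K)" by linarith
    then have "n ^ a \<le> (2 * K * (n div K)) ^ a" by (rule power_mono) simp
    also have "\<dots> = (2 * K) ^ a * (n div K) ^ a" by (rule power_mult_distrib)
    also have "\<dots> \<le> (2 * K) ^ a * f n" using assms(2) by (rule mult_left_mono) simp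
    finally have "real (n ^ a) \<le> real ((2 * K) ^ a * f n)" by (rule of_nat_mono)
    then show ?case by simp
  qed
qed

theorem theorem1p8:
  fixes r l \<alpha> :: nat
  assumes "r \<ge> 2" and "1 \<le> l" and "l \<le> r - 1"
    and "\<alpha> = max l (r - nat \<lceil>(real l + 1) / 2\<rceil>)"
  shows "(\<lambda>n. real (ex_ord r n (ord_family r (two_edges r l)))) \<in> \<Omega>(\<lambda>n. real n ^ \<alpha>)
    \<and> (odd l \<longrightarrow>
         (\<lambda>n. real (ex_ord r n (ord_family r (two_edges r l)))) \<in> O(\<lambda>n. real n ^ \<alpha>))
    \<and> (even l \<longrightarrow>
         (\<lambda>n. real (ex_ord r n (ord_family r (two_edges r l)))) \<in> O(\<lambda>n. real n ^ \<alpha> * ln (real n)))"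
proof (intro conjI impI)
  let ?ex = "\<lambda>n. ex_ord r n (ord_family r (two_edges r l))"
  \<comment> \<open>The ceiling of \<open>(l + 1) / 2\<close> for either parity, and the least
    number of pairs with more than \<open>l\<close> entries.\<close>
  define h where "h = l div 2 + 1"
  have "\<lceil>(real l + 1) / 2\<rceil> = int h"
    by (cases "even l") (auto elim!: evenE oddE simp: h_def intro!: ceiling_unique)
  then have \<alpha>: "\<alpha> = max l (r - h)" using assms(4) by simp
  have lr: "0 < l" "l < r" using assms by auto
  have \<alpha>r: "\<alpha> < r" "l \<le> \<alpha>" using \<alpha> lr by (auto simp: h_def)
  \<comment> \<open>As \<open>(l + 1) div 2 + h = l + 1\<close>, the inequality
    \<open>2 * r \<le> k + \<alpha> + 1 + l\<close> follows from
    \<open>r - h \<le> \<alpha>\<close>.\<close>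
  define k where "k = r - (l + 1) div 2"
  have k: "0 < k" "k \<le> r" "k \<le> \<alpha> + 1" "2 * r \<le> k + \<alpha> + 1 + l"
    using \<alpha> lr by (auto simp: k_def h_def)
  \<comment> \<open>For odd \<open>l\<close> one has \<open>k = r - h\<close>. For even
    \<open>l\<close> it is \<open>r - h + 1\<close>, which exceeds \<alpha> when
    \<open>\<alpha> = r - h\<close>.\<close>
  have k_odd: "k \<le> \<alpha>" if "odd l"
    using that \<alpha> by (auto simp: k_def h_def elim!: oddE)

  show "(\<lambda>n. real (?ex n)) \<in> \<Omega>(\<lambda>n. real n ^ \<alpha>)"
  proof (cases "\<alpha> = l")
    case True
    have "(n div (r * l * r ^ l)) ^ l \<le> ?ex n" for n
    proof -
      have "r * (l * (n div (r * l * r ^ l)) * r ^ l) = (r * l * r ^ l) * (n div (r * l * r ^ l))"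
        by (simp only: mult_ac)
      also have "\<dots> \<le> n" by (rule times_div_less_eq_dividend)
      finally show ?thesis
        using ex_avoiding_tuples_polynomials[OF lr] card_le_ex_ord[OF lr(2)] by metis
    qed
    then have "(\<lambda>n. real n ^ l) \<in> O(\<lambda>n. real (?ex n))"
      using lr by (intro power_in_bigo_if_power_div_le[of "r * l * r ^ l"]) auto
    then show ?thesis using True by (simp add: bigomega_iff_bigo)
  next
    case False
    then have \<alpha>h: "\<alpha> = r - h" "l < r - h" using \<alpha> by (auto simp: max_def split: if_splits)
    \<comment> \<open>From \<open>h \<le> l < r - h\<close> there is room for \<open>h\<close>
      disjoint pairs.\<close>
    then have h: "2 * h \<le> r" "l < 2 * h" by (auto simp: h_def)
    have "(n div (2 * (r - h))) ^ (r - h) \<le> ?ex n" for n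
    proof -
      have "2 * ((r - h) * (n div (2 * (r - h)))) \<le> n"
        by (metis mult.assoc times_div_less_eq_dividend)
      then show ?thesis
        using ex_avoiding_tuples_pairs[OF h] card_le_ex_ord[OF lr(2)] by metis
    qed
    then have "(\<lambda>n. real n ^ \<alpha>) \<in> O(\<lambda>n. real (?ex n))"
      unfolding \<alpha>h(1) using \<alpha>h(2) by (intro power_in_bigo_if_power_div_le[of "2 * (r - h)"]) auto
    then show ?thesis by (simp add: bigomega_iff_bigo)
  qed

  define C where "C = real ((2 * k) ^ r * distance_const r * 2 ^ \<alpha>)"
  have "0 \<le> C" by (simp add: C_def)
  have upper: "real (?ex n) \<le> C * ((if k \<le> \<alpha> then 2 else 6 * ln (real n)) * real n ^ \<alpha>)" if "2 \<le> n" for n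
  proof -
    obtain A where A: "avoiding_tuples r l n A" "?ex n \<le> card A"
      using ex_avoiding_tuples_ex_ord_le by blast
    then show ?thesis
      using card_avoiding_tuples_le[OF A(1) lr(2) \<alpha>r k(4,1,2,3) that] unfolding C_def by linarith
  qed
  show "(\<lambda>n. real (?ex n)) \<in> O(\<lambda>n. real n ^ \<alpha>)" if "odd l"
  proof (rule bigoI)
    show "\<forall>\<^sub>F n in at_top. norm (real (?ex n)) \<le> C * 2 * norm (real n ^ \<alpha>)"
      using eventually_ge_at_top[of 2]
    proof eventually_elim
      case (elim n)
      then show ?case using upper[OF elim] k_odd[OF that] by (simp add: mult.assoc)
    qed
  qed
  show "(\<lambda>n. real (?ex n)) \<in> O(\<lambda>n. real n ^ \<alpha> * ln (real n))"
  proof (rule bigoI)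
    show "\<forall>\<^sub>F n in at_top. norm (real (?ex n)) \<le> C * 6 * norm (real n ^ \<alpha> * ln (real n))"
      using eventually_ge_at_top[of 2]
    proof eventually_elim
      case (elim n)
      have "1 / 2 \<le> ln (2::real)" using ln_le_minus_one[of "1 / 2 :: real"] by (simp add: ln_div)
      moreover have "ln 2 \<le> ln (real n)" using elim by simp
      \<comment> \<open>This lets the logarithmic factor also cover the case
        \<open>k \<le> \<alpha>\<close>, whose factor is \<open>2\<close>.\<close>
      ultimately have ln: "2 \<le> 6 * ln (real n)" by linarith
      have "real (?ex n) \<le> C * ((if k \<le> \<alpha> then 2 else 6 * ln (real n)) * real n ^ \<alpha>)"
        by (rule upper[OF elim])
      also have "\<dots> \<le> C * ((6 * ln (real n)) * real n ^ \<alpha>)"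
        using ln \<open>0 \<le> C\<close> by (intro mult_left_mono mult_right_mono) auto
      finally show ?case using ln by (simp add: abs_mult mult_ac)
    qed
  qed
qed

end
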